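(* Let $n\ge1$ be an integer, $k\ge\frac{n-1}{2n}$ with $2k+\frac2n-2>0$, and $T>0$. Let $u\in C^1([0,T],W^2_{k,n})$ be a solution of $$n|x|^{2-\frac2n}\Delta_k^x u(t,x)-\partial_t u(t,x)=0,\qquad (t,x)\in[0,T]\times\mathbb{R},$$ with initial datum $u_0=u(0,\cdot)\in L^2_{k,n}$, and assume moreover $u_0\in L^1_{k,n}$ and that there are constants $C,\delta>0$ with $$|u(T,x)|\le C\,e^{-n\delta|x|^{2/n}}\qquad\text{for all }x\in\mathbb{R}.$$ If $\delta\ge\frac1{4T}$, then $u=0$ (i.e. $u(t,\cdot)=0$ a.e. for all $t\in[0,T]$).
   Context: Notation: $\alpha=kn-\frac n2$; $j_\beta$ is the normalized Bessel function $j_\beta(z)=\Gamma(\beta+1)\sum_{m\ge0}\frac{(-1)^m}{m!\Gamma(\beta+m+1)}(z/2)^{2m}$; $d\mu_{k,n}(x)=\frac{1}{2\Gamma(kn-\frac n2+1)}(\frac n2)^{kn-\frac n2}|x|^{2k+\frac2n-2}dx$, $L^p_{k,n}=L^p(\mathbb{R},d\mu_{k,n})$. The $(k,\frac2n)$-generalized Fourier transform is $\mathcal{F}_{k,n}f(\lambda)=\int_{\mathbb{R}}f(x)B_{k,n}(x,\lambda)d\mu_{k,n}(x)$ with kernel $B_{k,n}(x,\lambda)=j_\alpha(n|\lambda x|^{1/n})+(-i)^n(\frac n2)^n\frac{\Gamma(\alpha+1)}{\Gamma(\alpha+n+1)}\lambda x\,j_{\alpha+n}(n|\lambda x|^{1/n})$,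 extended to a unitary operator on $L^2_{k,n}$. The one-dimensional Dunkl Laplacian is $\Delta_kf(x)=f''(x)+\frac{2k}{x}f'(x)-k\frac{f(x)-f(-x)}{x^2}$ ($x\neq0$). The Sobolev-type space $W^2_{k,n}$ is the set of $f\in L^2_{k,n}$ with $|x|^{2-\frac2n}\Delta_kf\in L^2_{k,n}$, where on $L^2_{k,n}$ this operator is characterized by $\mathcal{F}_{k,n}\big(|x|^{2-\frac2n}\Delta_k f\big)(\xi)=-|\xi|^{2/n}\mathcal{F}_{k,n}f(\xi)$. *)

theory Defs
  imports "HOL-Analysis.Analysis"
begin

definition alpha_kn :: "real \<Rightarrow> nat \<Rightarrow> real" where
  "alpha_kn k n = k * real n - real n / 2"

definition bessel_j :: "real \<Rightarrow> real \<Rightarrow> real" where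
  "bessel_j \<beta> z = Gamma (\<beta> + 1) *
     (\<Sum>m. (-1) ^ m / (fact m * Gamma (\<beta> + real m + 1)) * (z / 2) ^ (2 * m))"

definition mu_kn :: "real \<Rightarrow> nat \<Rightarrow> real measure" where
  "mu_kn k n = density lborel (\<lambda>x. ennreal
      ((real n / 2) powr (alpha_kn k n) / (2 * Gamma (alpha_kn k n + 1))
        * \<bar>x\<bar> powr (2 * k + 2 / real n - 2)))"

definition memL :: "real \<Rightarrow> nat \<Rightarrow> real \<Rightarrow> (real \<Rightarrow> complex) \<Rightarrow> bool" where
  "memL k n p f \<longleftrightarrow> f \<in> borel_measurable (mu_kn k n)
      \<and> integrable (mu_kn k n) (\<lambda>x. norm (f x) powr p)"

definition L2norm :: "real \<Rightarrow> nat \<Rightarrow> (real \<Rightarrow> complex) \<Rightarrow> real" where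
  "L2norm k n f = sqrt (\<integral>x. (norm (f x))\<^sup>2 \<partial>(mu_kn k n))"

definition kernel_B :: "real \<Rightarrow> nat \<Rightarrow> real \<Rightarrow> real \<Rightarrow> complex" where
  "kernel_B k n x lam =
     complex_of_real (bessel_j (alpha_kn k n) (real n * \<bar>lam * x\<bar> powr (1 / real n)))
     + (- \<i>) ^ n * complex_of_real ((real n / 2) ^ n * Gamma (alpha_kn k n + 1)
         / Gamma (alpha_kn k n + real n + 1) * lam * x
         * bessel_j (alpha_kn k n + real n) (real n * \<bar>lam * x\<bar> powr (1 / real n)))"

definition FT1 :: "real \<Rightarrow> nat \<Rightarrow> (real \<Rightarrow> complex) \<Rightarrow> real \<Rightarrow> complex" where
  "FT1 k n f lam = (\<integral>x. f x * kernel_B k n x lam \<partial>(mu_kn k n))"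

text \<open>Its unitary extension to L^2: g is (a representative of) the L^2 transform
  of f iff g is the L^2-limit of the transforms of the truncations f 1_[-R,R].\<close>
definition FT2 :: "real \<Rightarrow> nat \<Rightarrow> (real \<Rightarrow> complex) \<Rightarrow> (real \<Rightarrow> complex) \<Rightarrow> bool" where
  "FT2 k n f g \<longleftrightarrow> memL k n 2 g \<and>
     ((\<lambda>R. L2norm k n (\<lambda>\<xi>. FT1 k n (\<lambda>x. indicator {-R..R} x * f x) \<xi> - g \<xi>))
        \<longlongrightarrow> 0) at_top"

text \<open>g represents |x|^{2-2/n} Delta_k f on L^2, characterized via the transform.\<close>
definition is_wlap :: "real \<Rightarrow> nat \<Rightarrow> (real \<Rightarrow> complex) \<Rightarrow> (real \<Rightarrow> complex) \<Rightarrow> bool" where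
  "is_wlap k n f g \<longleftrightarrow> memL k n 2 f \<and> memL k n 2 g \<and>
     (\<exists>Ff Fg. FT2 k n f Ff \<and> FT2 k n g Fg \<and>
        (AE \<xi> in mu_kn k n. Fg \<xi> = - complex_of_real (\<bar>\<xi>\<bar> powr (2 / real n)) * Ff \<xi>))"

definition in_W2 :: "real \<Rightarrow> nat \<Rightarrow> (real \<Rightarrow> complex) \<Rightarrow> bool" where
  "in_W2 k n f \<longleftrightarrow> (\<exists>g. is_wlap k n f g)"

definition wlap :: "real \<Rightarrow> nat \<Rightarrow> (real \<Rightarrow> complex) \<Rightarrow> real \<Rightarrow> complex" where
  "wlap k n f = (SOME g. is_wlap k n f g)"

definition W2norm :: "real \<Rightarrow> nat \<Rightarrow> (real \<Rightarrow> complex) \<Rightarrow> real" where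
  "W2norm k n f = L2norm k n f + L2norm k n (wlap k n f)"

definition C1_W2 :: "real \<Rightarrow> nat \<Rightarrow> real \<Rightarrow> (real \<Rightarrow> real \<Rightarrow> complex)
    \<Rightarrow> (real \<Rightarrow> real \<Rightarrow> complex) \<Rightarrow> bool" where
  "C1_W2 k n T u u' \<longleftrightarrow>
     (\<forall>t\<in>{0..T}. in_W2 k n (u t) \<and> in_W2 k n (u' t))
     \<and> (\<forall>t\<in>{0..T}. ((\<lambda>s. W2norm k n (\<lambda>x. (u s x - u t x) / complex_of_real (s - t) - u' t x))
            \<longlongrightarrow> 0) (at t within {0..T}))
     \<and> (\<forall>t\<in>{0..T}. ((\<lambda>s. W2norm k n (\<lambda>x. u' s x - u' t x)) \<longlongrightarrow> 0) (at t within {0..T}))"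

end

theory Submission
  imports Defs "HOL-Complex_Analysis.Complex_Analysis"
begin

text \<open>
  Write \<open>rad x = |x|^(2/n)\<close> and, for \<open>j = 0, 1\<close>, pair a function \<open>f\<close> with the Gaussians
  \<open>gauss j p x = x^j * exp (- p * rad x)\<close>, \<open>Re p > 0\<close>; these pairings determine \<open>f\<close>. The transform maps
  \<open>gauss j s\<close> to a multiple of \<open>s^-(\<beta> + 1) * gauss j (n^2 / 4 s)\<close> with \<open>\<beta> = \<alpha> + j n\<close>, so after the
  substitution \<open>p = n^2 / 4 s\<close> the operator acts on pairings as \<open>d/ds\<close> and the heat flow as the
  translation \<open>s \<mapsto> s + n t\<close>. Hence, with \<open>\<rho> = n / 4 T\<close>, the pairing \<open>V q\<close> of the initial datum with
  \<open>gauss j (\<rho> q)\<close> equals \<open>(1 / (1 - q))^(\<beta> + 1) * W (q / (1 - q))\<close> for \<open>0 < q < 1\<close>, where \<open>W\<close> is the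
  corresponding pairing of the final datum. Now \<open>V\<close> is holomorphic for \<open>Re q > 0\<close>, whereas the decay
  of \<open>u(T)\<close> with \<open>\<delta> \<ge> 1 / 4 T\<close> makes the right-hand side holomorphic for \<open>Re q < 1\<close>.
  So \<open>V\<close> is entire, of polynomial growth, and tends to \<open>0\<close> along the positive axis; by Liouville it vanishes.
\<close>

section \<open>Integration\<close>

lemma integrable_mult_if_square_integrable:
  fixes f g :: "'a \<Rightarrow> 'b::{real_normed_field,banach,second_countable_topology}"
  assumes [measurable]: "f \<in> borel_measurable M" "g \<in> borel_measurable M"
    and "integrable M (\<lambda>x. (norm (f x))\<^sup>2)" "integrable M (\<lambda>x. (norm (g x))\<^sup>2)"
  shows "integrable M (\<lambda>x. f x * g x)"
proof (rule Bochner_Integration.integrable_bound)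
  show "integrable M (\<lambda>x. (norm (f x))\<^sup>2 + (norm (g x))\<^sup>2)"
    using assms by simp
  have "norm (f x * g x) \<le> (norm (f x))\<^sup>2 + (norm (g x))\<^sup>2" for x
    using sum_squares_bound[of "norm (f x)" "norm (g x)"]
      mult_nonneg_nonneg[OF norm_ge_zero norm_ge_zero, of "f x" "g x"]
    unfolding norm_mult mult.assoc by linarith
  then show "AE x in M. norm (f x * g x) \<le> norm ((norm (f x))\<^sup>2 + (norm (g x))\<^sup>2)"
    by simp
qed simp

lemma Cauchy_Schwarz_integral:
  fixes f g :: "'a \<Rightarrow> 'b::{real_normed_field,banach,second_countable_topology}"
  assumes [measurable]: "f \<in> borel_measurable M" "g \<in> borel_measurable M"
    and f2: "integrable M (\<lambda>x. (norm (f x))\<^sup>2)" and g2: "integrable M (\<lambda>x. (norm (g x))\<^sup>2)"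
  shows "norm (\<integral>x. f x * g x \<partial>M)
           \<le> sqrt (\<integral>x. (norm (f x))\<^sup>2 \<partial>M) * sqrt (\<integral>x. (norm (g x))\<^sup>2 \<partial>M)"
proof -
  have square: "(\<integral>\<^sup>+x. (ennreal (norm (h x)))\<^sup>2 \<partial>M) = ennreal (\<integral>x. (norm (h x))\<^sup>2 \<partial>M)"
    if "integrable M (\<lambda>x. (norm (h x))\<^sup>2)" for h :: "'a \<Rightarrow> 'b"
    using nn_integral_eq_integral[OF that] by (simp add: ennreal_power)
  have product: "(\<integral>\<^sup>+x. ennreal (norm (f x)) * ennreal (norm (g x)) \<partial>M)
      = ennreal (\<integral>x. norm (f x * g x) \<partial>M)"
    using nn_integral_eq_integral[OF integrable_norm[OF integrable_mult_if_square_integrable[OF assms]]]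
    by (simp add: norm_mult ennreal_mult)
  have "(\<integral>x. norm (f x * g x) \<partial>M)\<^sup>2 \<le> (\<integral>x. (norm (f x))\<^sup>2 \<partial>M) * (\<integral>x. (norm (g x))\<^sup>2 \<partial>M)"
    using Cauchy_Schwarz_nn_integral[of "\<lambda>x. norm (f x)" M "\<lambda>x. norm (g x)"]
    unfolding square[OF f2] square[OF g2] product
    by (simp add: ennreal_power flip: ennreal_mult)
  then have "(\<integral>x. norm (f x * g x) \<partial>M)
      \<le> sqrt (\<integral>x. (norm (f x))\<^sup>2 \<partial>M) * sqrt (\<integral>x. (norm (g x))\<^sup>2 \<partial>M)"
    by (simp add: real_le_rsqrt flip: real_sqrt_mult)
  then show ?thesis
    by (rule order.trans[OF integral_norm_bound])
qed

lemma integral_dominated_convergence_within: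
  fixes f :: "'c::first_countable_topology \<Rightarrow> 'a \<Rightarrow> 'b::{banach,second_countable_topology}"
  assumes "g \<in> borel_measurable M" "\<And>y. y \<in> S \<Longrightarrow> f y \<in> borel_measurable M" "integrable M w"
    and lim: "AE x in M. ((\<lambda>y. f y x) \<longlongrightarrow> g x) (at a within S)"
    and bound: "\<And>y. y \<in> S - {a} \<Longrightarrow> AE x in M. norm (f y x) \<le> w x"
  shows "((\<lambda>y. \<integral>x. f y x \<partial>M) \<longlongrightarrow> (\<integral>x. g x \<partial>M)) (at a within S)"
  unfolding tendsto_at_iff_sequentially comp_def
proof (intro allI impI)
  fix X assume X: "\<forall>i. X i \<in> S - {a}" "X \<longlonglongrightarrow> a"
  show "(\<lambda>i. \<integral>x. f (X i) x \<partial>M) \<longlonglongrightarrow> (\<integral>x. g x \<partial>M)"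
  proof (rule integral_dominated_convergence)
    show "AE x in M. (\<lambda>i. f (X i) x) \<longlonglongrightarrow> g x"
      using lim by eventually_elim (use X in \<open>auto simp: tendsto_at_iff_sequentially comp_def\<close>)
    show "AE x in M. norm (f (X i) x) \<le> w x" for i
      using X by (intro bound) auto
  qed (use assms(1-3) X in auto)
qed

lemma integral_scaleR_bounded_convergence:
  fixes h :: "'a \<Rightarrow> 'b::{banach,second_countable_topology}" and P :: "nat \<Rightarrow> 'a \<Rightarrow> real"
  assumes h: "integrable M h"
    and [measurable]: "\<And>m. P m \<in> borel_measurable M" "G \<in> borel_measurable M"
    and lim: "AE x in M. (\<lambda>m. P m x) \<longlonglongrightarrow> G x" and bound: "\<And>m. AE x in M. \<bar>P m x\<bar> \<le> B"
  shows "(\<lambda>m. \<integral>x. P m x *\<^sub>R h x \<partial>M) \<longlonglongrightarrow> (\<integral>x. G x *\<^sub>R h x \<partial>M)"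
proof (rule integral_dominated_convergence)
  have [measurable]: "h \<in> borel_measurable M" using h by auto
  show "(\<lambda>x. G x *\<^sub>R h x) \<in> borel_measurable M" "(\<lambda>x. P m x *\<^sub>R h x) \<in> borel_measurable M" for m
    by measurable
  show "integrable M (\<lambda>x. B * norm (h x))"
    using h by simp
  show "AE x in M. (\<lambda>m. P m x *\<^sub>R h x) \<longlonglongrightarrow> G x *\<^sub>R h x"
    using lim by eventually_elim (intro tendsto_intros)
  show "AE x in M. norm (P m x *\<^sub>R h x) \<le> B * norm (h x)" for m
    using bound[of m] by eventually_elim (simp add: mult_right_mono)
qed

lemma integrable_Fatou:
  fixes f :: "nat \<Rightarrow> 'a \<Rightarrow> real"
  assumes int: "\<And>m. integrable M (f m)" and nonneg: "\<And>m. AE x in M. 0 \<le> f m x"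
    and bound: "\<And>m. (\<integral>x. f m x \<partial>M) \<le> N" and lim: "AE x in M. (\<lambda>m. f m x) \<longlonglongrightarrow> g x"
    and [measurable]: "g \<in> borel_measurable M"
  shows "integrable M g"
proof -
  have [measurable]: "f m \<in> borel_measurable M" for m using int by blast
  have "AE x in M. \<forall>m. 0 \<le> f m x" using nonneg by (simp add: AE_all_countable)
  with lim have "AE x in M. ennreal (norm (g x)) = liminf (\<lambda>m. ennreal (f m x))"
  proof eventually_elim
    case (elim x)
    then have "0 \<le> g x" by (auto intro: LIMSEQ_le_const)
    with elim show ?case
      by (auto intro!: lim_imp_Liminf[symmetric] tendsto_ennrealI)
  qed
  then have "(\<integral>\<^sup>+x. ennreal (norm (g x)) \<partial>M) = (\<integral>\<^sup>+x. liminf (\<lambda>m. ennreal (f m x)) \<partial>M)"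
    by (rule nn_integral_cong_AE)
  also have "\<dots> \<le> liminf (\<lambda>m. \<integral>\<^sup>+x. ennreal (f m x) \<partial>M)"
    by (rule nn_integral_liminf) simp
  also have "\<dots> \<le> ennreal N"
    unfolding nn_integral_eq_integral[OF int nonneg]
    using bound by (intro Liminf_le always_eventually allI) (auto intro: ennreal_leI)
  finally show ?thesis
    by (auto simp: integrable_iff_bounded intro: order.strict_trans1)
qed

lemma AE_zero_if_set_integrals_zero:
  fixes h :: "'a \<Rightarrow> 'b::euclidean_space"
  assumes h: "integrable M h" and zero: "\<And>A. A \<in> sets M \<Longrightarrow> (LINT x:A|M. h x) = 0"
  shows "AE x in M. h x = 0"
proof -
  have "AE x in M. h x \<bullet> b = 0" for b
  proof (rule density_unique_real)
    fix A assume A: "A \<in> sets M"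
    then have "integrable M (\<lambda>x. indicator A x *\<^sub>R h x)"
      by (rule integrable_mult_indicator[OF _ h])
    then have "(LINT x:A|M. h x \<bullet> b) = (LINT x:A|M. h x) \<bullet> b"
      unfolding set_lebesgue_integral_def by (subst integral_inner_left[symmetric]) auto
    then show "(LINT x:A|M. h x \<bullet> b) = (LINT x:A|M. 0)"
      using zero[OF A] by simp
  qed (use h in auto)
  then have "AE x in M. \<forall>b\<in>Basis. h x \<bullet> b = 0"
    by (intro AE_finite_allI) auto
  then show ?thesis
    by eventually_elim (auto intro: euclidean_eqI)
qed

lemma AE_zero_if_integrals_greaterThan_zero:
  fixes h :: "real \<Rightarrow> 'b::euclidean_space"
  assumes borel: "sets M = sets borel" and h: "integrable M h"
    and total: "(\<integral>t. h t \<partial>M) = 0" and tail: "\<And>c. (LINT t:{c<..}|M. h t) = 0"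
  shows "AE t in M. h t = 0"
proof (rule AE_zero_if_set_integrals_zero[OF h])
  have set_int: "set_integrable M A h" if "A \<in> sets borel" for A
    using integrable_mult_indicator[OF _ h, of A] that by (simp add: set_integrable_def borel)
  have "Int_stable (range (greaterThan :: real \<Rightarrow> real set))"
    by (auto simp: Int_stable_def lessThan_Int_lessThan)
  moreover have "range (greaterThan :: real \<Rightarrow> real set) \<subseteq> Pow UNIV"
    by simp
  moreover fix A assume "A \<in> sets M"
  then have "A \<in> sigma_sets UNIV (range greaterThan)"
    by (simp add: borel borel_Ioi)
  ultimately show "(LINT t:A|M. h t) = 0"
  proof (induction rule: sigma_sets_induct_disjoint)
    case (compl A)
    then have "A \<in> sets borel" by (simp add: borel_Ioi)
    then have "(LINT t:A \<union> (UNIV - A)|M. h t) = (LINT t:A|M. h t) + (LINT t:UNIV - A|M. h t)"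
      by (intro set_integral_Un set_int) auto
    then show ?case
      using compl.IH total by (simp add: set_lebesgue_integral_def)
  next
    case (union A)
    then have borel_A: "A i \<in> sets borel" for i by (auto simp: borel_Ioi)
    have "(LINT t:(\<Union>i. A i)|M. h t) = (\<Sum>i. LINT t:A i|M. h t)"
      using borel_A union(1) by (intro lebesgue_integral_countable_add set_int)
        (auto simp: borel disjoint_family_on_def)
    then show ?case using union.IH by simp
  qed (use tail in \<open>auto simp: set_lebesgue_integral_def\<close>)
qed

subsection \<open>Polynomials on the unit interval\<close>

lemma Weierstrass_bounded_convergence:
  fixes G :: "'a::euclidean_space \<Rightarrow> real"
  assumes S: "compact S" and G: "continuous_on S G"
  obtains P B where "\<And>m. real_polynomial_function (P m)"
    and "\<And>t. t \<in> S \<Longrightarrow> (\<lambda>m::nat. P m t) \<longlonglongrightarrow> G t" and "\<And>t m. t \<in> S \<Longrightarrow> \<bar>P m t\<bar> \<le> B"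
proof -
  have "\<exists>p. real_polynomial_function p \<and> (\<forall>t\<in>S. \<bar>G t - p t\<bar> < inverse (real (Suc m)))" for m
  proof (rule Stone_Weierstrass_real_polynomial_function[OF S G])
    show "0 < inverse (real (Suc m))" by simp
  qed blast
  then obtain P where P: "\<And>m. real_polynomial_function (P m)"
    and approx: "\<And>t m. t \<in> S \<Longrightarrow> \<bar>G t - P m t\<bar> < inverse (real (Suc m))"
    by metis
  obtain B where B: "\<And>t. t \<in> S \<Longrightarrow> \<bar>G t\<bar> \<le> B"
    using compact_imp_bounded[OF compact_continuous_image[OF G S]]
    unfolding bounded_iff by (metis imageI real_norm_def)
  show thesis
  proof (rule that[OF P])
    fix t m assume t: "t \<in> S"
    have "\<bar>P m t - G t\<bar> \<le> inverse (real (Suc m))" for m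
      using approx[OF t, of m] by linarith
    then have "(\<lambda>m. P m t - G t) \<longlonglongrightarrow> 0"
      by (intro Lim_null_comparison[OF _ LIMSEQ_inverse_real_of_nat]) simp
    then show "(\<lambda>m. P m t) \<longlonglongrightarrow> G t" by (simp add: LIM_zero_iff)
    have "inverse (real (Suc m)) \<le> 1" by (simp add: field_simps)
    then show "\<bar>P m t\<bar> \<le> B + 1" using approx[OF t, of m] B[OF t] by linarith
  qed
qed

lemma real_polynomial_function_borel_measurable:
  fixes P :: "'a::euclidean_space \<Rightarrow> real"
  assumes "real_polynomial_function P"
  shows "P \<in> borel_measurable borel"
  by (intro borel_measurable_continuous_onI continuous_at_imp_continuous_on ballI
      continuous_real_polymonial_function assms)

lemma continuous_integral_zero_if_moments_zero:
  fixes h :: "real \<Rightarrow> 'b::{banach,second_countable_topology}"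
  assumes borel: "sets M = sets borel" and unit: "AE t in M. t \<in> {0..1}" and h: "integrable M h"
    and moments: "\<And>i::nat. (\<integral>t. t ^ i *\<^sub>R h t \<partial>M) = 0" and G: "continuous_on UNIV G"
  shows "(\<integral>t. G t *\<^sub>R h t \<partial>M) = 0"
proof -
  have [measurable_cong]: "sets M = sets borel" by (fact borel)
  have [measurable]: "G \<in> borel_measurable borel"
    by (rule borel_measurable_continuous_onI[OF G])
  obtain P B where P: "\<And>m. real_polynomial_function (P m)"
    and lim: "\<And>t. t \<in> {0..1} \<Longrightarrow> (\<lambda>m. P m t) \<longlonglongrightarrow> G t" and bound: "\<And>t m. t \<in> {0..1} \<Longrightarrow> \<bar>P m t\<bar> \<le> B"
    by (rule Weierstrass_bounded_convergence[OF compact_Icc[of 0 1]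
      continuous_on_subset[OF G subset_UNIV]]) auto
  note [measurable] = real_polynomial_function_borel_measurable[OF P]
  have "(\<lambda>m. \<integral>t. P m t *\<^sub>R h t \<partial>M) \<longlonglongrightarrow> (\<integral>t. G t *\<^sub>R h t \<partial>M)"
  proof (rule integral_scaleR_bounded_convergence[OF h])
    show "AE t in M. (\<lambda>m. P m t) \<longlonglongrightarrow> G t"
      using unit by eventually_elim (rule lim)
    show "AE t in M. \<bar>P m t\<bar> \<le> B" for m
      using unit by eventually_elim (rule bound)
  qed measurable
  moreover have "(\<integral>t. P m t *\<^sub>R h t \<partial>M) = 0" for m
  proof -
    obtain a d where "P m = (\<lambda>t. \<Sum>i\<le>d. a i * t ^ i)"
      using P[of m] by (auto simp: real_polynomial_function_iff_sum)
    moreover have "integrable M (\<lambda>t. t ^ i *\<^sub>R h t)" for i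
    proof (rule Bochner_Integration.integrable_bound[OF h])
      show "AE t in M. norm (t ^ i *\<^sub>R h t) \<le> norm (h t)"
        using unit by eventually_elim (simp add: power_abs mult_left_le_one_le power_le_one)
    qed (use h in measurable)
    then have "(\<integral>t. (\<Sum>i\<le>d. a i *\<^sub>R t ^ i *\<^sub>R h t) \<partial>M) = (\<Sum>i\<le>d. a i *\<^sub>R (\<integral>t. t ^ i *\<^sub>R h t \<partial>M))"
      by (simp only: Bochner_Integration.integral_sum integrable_scaleR_right integral_scaleR_right)
    ultimately show ?thesis
      by (simp add: moments scaleR_sum_left)
  qed
  ultimately show ?thesis by (simp add: LIMSEQ_const_iff)
qed

lemma AE_zero_if_moments_zero:
  fixes h :: "real \<Rightarrow> 'b::euclidean_space"
  assumes borel: "sets M = sets borel" and unit: "AE t in M. t \<in> {0..1}" and h: "integrable M h"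
    and moments: "\<And>i::nat. (\<integral>t. t ^ i *\<^sub>R h t \<partial>M) = 0"
  shows "AE t in M. h t = 0"
proof (rule AE_zero_if_integrals_greaterThan_zero[OF borel h])
  show "(\<integral>t. h t \<partial>M) = 0" using moments[of 0] by simp
  fix c :: real
  have [measurable_cong]: "sets M = sets borel" by (fact borel)
  define ramp where "ramp m t = min 1 (max 0 (real m * (t - c)))" for m t
  have ramp: "continuous_on UNIV (ramp m)" for m
    unfolding ramp_def by (intro continuous_intros)
  note [measurable] = borel_measurable_continuous_onI[OF ramp]
  have "(\<lambda>m. ramp m t) \<longlonglongrightarrow> indicator {c<..} t" for t
  proof (cases "t > c")
    case True
    obtain m0 where "real m0 > 1 / (t - c)" using reals_Archimedean2 by blast
    then have "ramp m t = indicator {c<..} t" if "m \<ge> m0" for m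
    proof -
      have "1 / (t - c) \<le> real m" using \<open>real m0 > 1 / (t - c)\<close> that by simp
      then have "1 \<le> real m * (t - c)" using True by (simp add: field_simps)
      then show ?thesis using True by (simp add: ramp_def)
    qed
    then show ?thesis
      by (intro tendsto_eventually) (auto simp: eventually_sequentially)
  next
    case False
    then have "ramp m t = 0" for m by (simp add: ramp_def max_absorb1 mult_nonneg_nonpos)
    then show ?thesis using False by simp
  qed
  then have "(\<lambda>m. \<integral>t. ramp m t *\<^sub>R h t \<partial>M) \<longlonglongrightarrow> (\<integral>t. indicator {c<..} t *\<^sub>R h t \<partial>M)"
    by (intro integral_scaleR_bounded_convergence[OF h, where B = 1]) (auto simp: ramp_def)
  then show "(LINT t:{c<..}|M. h t) = 0"
    using continuous_integral_zero_if_moments_zero[OF assms ramp]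
    by (simp add: LIMSEQ_const_iff set_lebesgue_integral_def)
qed

lemma continuous_duality_bound_if_polynomial:
  fixes F v \<tau> :: "'a \<Rightarrow> real"
  assumes [measurable]: "v \<in> borel_measurable M" "\<tau> \<in> borel_measurable M"
    and unit: "AE x in M. \<tau> x \<in> {0..1}"
    and v2: "integrable M (\<lambda>x. (v x)\<^sup>2)" and Fv: "integrable M (\<lambda>x. F x * v x)"
    and bound: "\<And>P. real_polynomial_function P \<Longrightarrow>
      (\<integral>x. F x * (v x * P (\<tau> x)) \<partial>M)\<^sup>2 \<le> N * (\<integral>x. (v x * P (\<tau> x))\<^sup>2 \<partial>M)"
    and G: "continuous_on {0..1} G" and [measurable]: "G \<in> borel_measurable borel"
  shows "(\<integral>x. F x * (v x * G (\<tau> x)) \<partial>M)\<^sup>2 \<le> N * (\<integral>x. (v x * G (\<tau> x))\<^sup>2 \<partial>M)"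
proof -
  obtain P B where P: "\<And>m. real_polynomial_function (P m)"
    and lim: "\<And>t. t \<in> {0..1} \<Longrightarrow> (\<lambda>m. P m t) \<longlonglongrightarrow> G t" and bd: "\<And>t m. t \<in> {0..1} \<Longrightarrow> \<bar>P m t\<bar> \<le> B"
    by (rule Weierstrass_bounded_convergence[OF compact_Icc G]) auto
  note [measurable] = real_polynomial_function_borel_measurable[OF P]
  have "(\<lambda>m. \<integral>x. P m (\<tau> x) *\<^sub>R (F x * v x) \<partial>M) \<longlonglongrightarrow> (\<integral>x. G (\<tau> x) *\<^sub>R (F x * v x) \<partial>M)"
  proof (rule integral_scaleR_bounded_convergence[OF Fv])
    show "AE x in M. (\<lambda>m. P m (\<tau> x)) \<longlonglongrightarrow> G (\<tau> x)" using unit by eventually_elim (rule lim)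
    show "AE x in M. \<bar>P m (\<tau> x)\<bar> \<le> B" for m using unit by eventually_elim (rule bd)
  qed measurable
  then have pairing: "(\<lambda>m. \<integral>x. F x * (v x * P m (\<tau> x)) \<partial>M) \<longlonglongrightarrow> (\<integral>x. F x * (v x * G (\<tau> x)) \<partial>M)"
    by (simp add: mult_ac)
  have "(\<lambda>m. \<integral>x. (P m (\<tau> x))\<^sup>2 *\<^sub>R (v x)\<^sup>2 \<partial>M) \<longlonglongrightarrow> (\<integral>x. (G (\<tau> x))\<^sup>2 *\<^sub>R (v x)\<^sup>2 \<partial>M)"
  proof (rule integral_scaleR_bounded_convergence[OF v2])
    show "AE x in M. (\<lambda>m. (P m (\<tau> x))\<^sup>2) \<longlonglongrightarrow> (G (\<tau> x))\<^sup>2"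
      using unit by eventually_elim (intro tendsto_power lim)
    show "AE x in M. \<bar>(P m (\<tau> x))\<^sup>2\<bar> \<le> B\<^sup>2" for m
      using unit by eventually_elim
        (simp add: abs_le_square_iff[symmetric] bd order.trans[OF bd abs_ge_self])
  qed measurable
  then have "(\<lambda>m. \<integral>x. (v x * P m (\<tau> x))\<^sup>2 \<partial>M) \<longlonglongrightarrow> (\<integral>x. (v x * G (\<tau> x))\<^sup>2 \<partial>M)"
    by (simp add: power_mult_distrib mult.commute)
  then show ?thesis
    using bound[OF P] by (intro LIMSEQ_le[OF tendsto_power[OF pairing] tendsto_mult_left]) auto
qed

definition unit_cutoff :: "nat \<Rightarrow> real \<Rightarrow> real" where
  "unit_cutoff m t = min 1 (max 0 (real m * (t * (1 - t)) - 1))"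

lemma unit_cutoff_nonneg: "0 \<le> unit_cutoff m t" and unit_cutoff_le_1: "unit_cutoff m t \<le> 1"
  by (auto simp: unit_cutoff_def)

lemma unit_cutoff_borel_measurable [measurable]: "unit_cutoff m \<in> borel_measurable borel"
  unfolding unit_cutoff_def by measurable

lemma unit_cutoff_tendsto_1:
  assumes t: "t \<in> {0<..<1}"
  shows "(\<lambda>m. unit_cutoff m t) \<longlonglongrightarrow> 1"
proof (rule tendsto_eventually)
  have pos: "t * (1 - t) > 0" using t by simp
  have "\<forall>\<^sub>F m in sequentially. 2 / (t * (1 - t)) \<le> real m"
    using filterlim_real_sequentially by (simp add: filterlim_at_top)
  then show "\<forall>\<^sub>F m in sequentially. unit_cutoff m t = 1"
    by eventually_elim (use pos in \<open>simp add: unit_cutoff_def field_simps\<close>)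
qed

lemma continuous_on_unit_cutoff_mult:
  assumes H: "continuous_on {0<..<1} H"
  shows "continuous_on {0..1} (\<lambda>t. unit_cutoff m t * H t)"
proof -
  define S where "S = {t \<in> {0..1}. real m * (t * (1 - t)) \<le> 1}"
  define S' where "S' = {t \<in> {0..1}. 1 \<le> real m * (t * (1 - t))}"
  have "S' \<subseteq> {0<..<1}"
  proof
    fix t assume "t \<in> S'"
    then show "t \<in> {0<..<1}" by (cases "t = 0 \<or> t = 1") (auto simp: S'_def)
  qed
  then have "continuous_on S' (\<lambda>t. unit_cutoff m t * H t)"
    unfolding unit_cutoff_def by (intro continuous_intros continuous_on_subset[OF H])
  moreover have "closed S" "closed S'"
    unfolding S_def S'_def
    by (intro closed_Collect_conj closed_Collect_le continuous_intros; simp add: closed_Collect_le)+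
  ultimately have "continuous_on (S \<union> S')
      (\<lambda>t. if real m * (t * (1 - t)) \<le> 1 then 0 else unit_cutoff m t * H t)"
    by (intro continuous_on_cases) (auto simp: S_def S'_def unit_cutoff_def)
  moreover have "S \<union> S' = {0..1}" by (auto simp: S_def S'_def)
  moreover have "(\<lambda>t. if real m * (t * (1 - t)) \<le> 1 then 0 else unit_cutoff m t * H t)
      = (\<lambda>t. unit_cutoff m t * H t)"
    by (auto simp: unit_cutoff_def)
  ultimately show ?thesis by (simp only:)
qed

lemma integrable_mult_continuous_on_compose:
  fixes h :: "'a \<Rightarrow> real"
  assumes h: "integrable M h" and [measurable]: "\<tau> \<in> borel_measurable M"
    "G \<in> borel_measurable borel"
    and S: "compact S" "AE x in M. \<tau> x \<in> S" and G: "continuous_on S G"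
  shows "integrable M (\<lambda>x. h x * G (\<tau> x))"
proof -
  obtain B where B: "\<And>t. t \<in> S \<Longrightarrow> \<bar>G t\<bar> \<le> B"
    using compact_imp_bounded[OF compact_continuous_image[OF G S(1)]]
    unfolding bounded_iff by (metis imageI real_norm_def)
  have [measurable]: "h \<in> borel_measurable M" using h by blast
  show ?thesis
  proof (rule Bochner_Integration.integrable_bound[OF integrable_mult_right[OF h, of B]])
    show "AE x in M. norm (h x * G (\<tau> x)) \<le> norm (B * h x)"
      using S(2)
    proof eventually_elim
      case (elim x)
      then have "\<bar>G (\<tau> x)\<bar> \<le> \<bar>B\<bar>" using B[of "\<tau> x"] by linarith
      then have "\<bar>G (\<tau> x)\<bar> * \<bar>h x\<bar> \<le> \<bar>B\<bar> * \<bar>h x\<bar>" by (rule mult_right_mono) simp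
      then show ?case by (simp add: abs_mult mult_ac)
    qed
  qed measurable
qed

context
  fixes M :: "'a measure" and F v \<tau> :: "'a \<Rightarrow> real" and H :: "real \<Rightarrow> real" and N :: real
  assumes [measurable]: "F \<in> borel_measurable M" "v \<in> borel_measurable M" "\<tau> \<in> borel_measurable M"
      "H \<in> borel_measurable borel"
    and unit: "AE x in M. \<tau> x \<in> {0<..<1}" and factor: "AE x in M. F x = v x * H (\<tau> x)"
    and H: "continuous_on {0<..<1} H"
    and v2: "integrable M (\<lambda>x. (v x)\<^sup>2)" and Fv: "integrable M (\<lambda>x. F x * v x)"
    and bound: "\<And>P. real_polynomial_function P \<Longrightarrow>
      (\<integral>x. F x * (v x * P (\<tau> x)) \<partial>M)\<^sup>2 \<le> N * (\<integral>x. (v x * P (\<tau> x))\<^sup>2 \<partial>M)"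
    and N: "N \<ge> 0"
begin

text \<open>Testing the bound against the truncation \<open>unit_cutoff m (\<tau> x) * F x\<close> gives \<open>I\<^sup>2 \<le> N * I\<close>
  for the truncated integral \<open>I\<close> of the square of \<open>F\<close>.\<close>

lemma truncated_square_integral:
  shows "integrable M (\<lambda>x. unit_cutoff m (\<tau> x) * (F x)\<^sup>2)"
    and "(\<integral>x. unit_cutoff m (\<tau> x) * (F x)\<^sup>2 \<partial>M) \<le> N"
proof -
  let ?G = "\<lambda>t. unit_cutoff m t * H t" and ?f = "\<lambda>x. unit_cutoff m (\<tau> x) * (F x)\<^sup>2"
  define I where "I = (\<integral>x. ?f x \<partial>M)"
  have unit': "AE x in M. \<tau> x \<in> {0..1}" using unit by eventually_elim simp
  have G: "continuous_on {0..1} ?G" by (rule continuous_on_unit_cutoff_mult[OF H])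
  have test: "AE x in M. F x * v x * ?G (\<tau> x) = ?f x"
    using factor by eventually_elim (simp add: power2_eq_square mult_ac)
  have "integrable M (\<lambda>x. F x * v x * ?G (\<tau> x))"
    by (rule integrable_mult_continuous_on_compose[OF Fv _ _ compact_Icc unit' G]) auto
  then show int: "integrable M ?f"
    by (subst integrable_cong_AE[OF _ _ test, symmetric]) auto
  have "AE x in M. (v x * ?G (\<tau> x))\<^sup>2 \<le> ?f x"
    using factor
  proof eventually_elim
    case (elim x)
    have "(unit_cutoff m (\<tau> x))\<^sup>2 \<le> unit_cutoff m (\<tau> x)"
      using unit_cutoff_nonneg unit_cutoff_le_1 by (simp add: power2_eq_square mult_left_le)
    then have "(unit_cutoff m (\<tau> x))\<^sup>2 * (F x)\<^sup>2 \<le> ?f x" by (rule mult_right_mono) simp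
    then show ?case by (simp add: elim power_mult_distrib mult_ac)
  qed
  then have "(\<integral>x. (v x * ?G (\<tau> x))\<^sup>2 \<partial>M) \<le> I"
    unfolding I_def by (intro integral_mono_AE'[OF int]) (auto simp: unit_cutoff_nonneg)
  then have "N * (\<integral>x. (v x * ?G (\<tau> x))\<^sup>2 \<partial>M) \<le> N * I"
    by (rule mult_left_mono[OF _ N])
  moreover have "(\<integral>x. F x * (v x * ?G (\<tau> x)) \<partial>M)\<^sup>2 \<le> N * (\<integral>x. (v x * ?G (\<tau> x))\<^sup>2 \<partial>M)"
    by (rule continuous_duality_bound_if_polynomial[OF _ _ unit' v2 Fv bound G]) auto
  moreover have "(\<integral>x. F x * v x * ?G (\<tau> x) \<partial>M) = I"
    unfolding I_def by (rule integral_cong_AE[OF _ _ test]) auto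
  ultimately have "I * I \<le> N * I" by (simp add: power2_eq_square mult.assoc)
  moreover have "I \<ge> 0" unfolding I_def
    by (intro Bochner_Integration.integral_nonneg) (simp add: unit_cutoff_nonneg)
  ultimately show "(\<integral>x. ?f x \<partial>M) \<le> N"
    using N by (cases "I = 0") (auto simp: I_def)
qed

lemma square_integrable_if_polynomial_duality_bound: "integrable M (\<lambda>x. (F x)\<^sup>2)"
proof (rule integrable_Fatou[OF truncated_square_integral(1) _ truncated_square_integral(2)])
  show "AE x in M. (\<lambda>m. unit_cutoff m (\<tau> x) * (F x)\<^sup>2) \<longlonglongrightarrow> (F x)\<^sup>2"
    using unit by eventually_elim (use tendsto_mult_right[OF unit_cutoff_tendsto_1] in force)
qed (auto simp: unit_cutoff_nonneg)

end

subsection \<open>The Laplace transform\<close>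

lemma norm_exp_minus_one_le:
  fixes z :: "'a::{banach,real_normed_field}"
  shows "norm (exp z - 1) \<le> norm z * exp (norm z)"
  using Taylor_exp_field[of z 0] by (simp add: mult.commute)

lemma le_exp_mult_divide:
  fixes e y :: real
  assumes "e > 0"
  shows "y \<le> exp (e * y) / e"
proof -
  have "e * y \<le> exp (e * y)" using exp_ge_add_one_self[of "e * y"] by linarith
  then show ?thesis using assms by (simp add: field_simps)
qed

lemma norm_exp_difference_quotient_le:
  fixes p h :: complex and y e :: real
  assumes y: "y \<ge> 0" and h: "h \<noteq> 0" "norm h \<le> e"
  shows "norm ((exp (- (p + h) * of_real y) - exp (- p * of_real y)) / h)
      \<le> exp (- (Re p - 2 * e) * y) / e"
proof -
  have e: "e > 0" using h by (meson less_le_trans zero_less_norm_iff)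
  have "exp (- (p + h) * of_real y) - exp (- p * of_real y)
      = exp (- p * of_real y) * (exp (- h * of_real y) - 1)"
    by (simp add: algebra_simps exp_add[symmetric])
  then have "norm ((exp (- (p + h) * of_real y) - exp (- p * of_real y)) / h)
      = exp (- Re p * y) * (norm (exp (- h * of_real y) - 1) / norm h)"
    by (simp add: norm_mult norm_divide)
  also have "\<dots> \<le> exp (- Re p * y) * (y * exp (norm h * y))"
    using norm_exp_minus_one_le[of "- h * of_real y"] y h
    by (intro mult_left_mono) (auto simp: norm_mult field_simps)
  also have "\<dots> \<le> exp (- Re p * y) * (exp (e * y) / e * exp (e * y))"
    using h y e by (intro mult_left_mono mult_mono le_exp_mult_divide) (auto intro: mult_right_mono)
  also have "\<dots> = exp (- (Re p - 2 * e) * y) / e"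
    by (simp add: algebra_simps flip: exp_add)
  finally show ?thesis .
qed

lemma tendsto_exp_difference_quotient:
  fixes p y :: complex
  shows "((\<lambda>h. (exp (- (p + h) * y) - exp (- p * y)) / h) \<longlongrightarrow> - y * exp (- p * y)) (at 0)"
proof -
  have "((\<lambda>p. exp (- p * y)) has_field_derivative - y * exp (- p * y)) (at p)"
    by (auto intro!: derivative_eq_intros)
  then show ?thesis by (simp only: DERIV_def)
qed

lemma has_field_derivative_Laplace:
  fixes g :: "'a \<Rightarrow> complex" and \<phi> :: "'a \<Rightarrow> real"
  assumes [measurable]: "g \<in> borel_measurable M" "\<phi> \<in> borel_measurable M"
    and \<phi>: "\<And>x. \<phi> x \<ge> 0"
    and int: "\<And>c. c > c0 \<Longrightarrow> integrable M (\<lambda>x. norm (g x) * exp (- c * \<phi> x))"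
    and p: "Re p > c0"
  shows "((\<lambda>p. \<integral>x. g x * exp (- p * of_real (\<phi> x)) \<partial>M) has_field_derivative
           (\<integral>x. - of_real (\<phi> x) * g x * exp (- p * of_real (\<phi> x)) \<partial>M)) (at p)"
proof -
  define e where "e = (Re p - c0) / 3"
  have e: "e > 0" "Re p - 2 * e > c0" using p by (auto simp: e_def field_simps)
  let ?E = "\<lambda>p x. exp (- p * complex_of_real (\<phi> x))"
  have int': "integrable M (\<lambda>x. g x * ?E q x)" if "Re q > c0" for q
    by (rule Bochner_Integration.integrable_bound[OF int[OF that]]) (auto simp: norm_mult)
  have "((\<lambda>h. \<integral>x. g x * ((?E (p + h) x - ?E p x) / h) \<partial>M)
      \<longlongrightarrow> (\<integral>x. g x * (- of_real (\<phi> x) * ?E p x) \<partial>M)) (at 0 within ball 0 e)"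
  proof (rule integral_dominated_convergence_within
      [where w = "\<lambda>x. norm (g x) * (exp (- (Re p - 2 * e) * \<phi> x) / e)"])
    show "integrable M (\<lambda>x. norm (g x) * (exp (- (Re p - 2 * e) * \<phi> x) / e))"
      using int[OF e(2)] by simp
    show "AE x in M. norm (g x * ((?E (p + h) x - ?E p x) / h))
        \<le> norm (g x) * (exp (- (Re p - 2 * e) * \<phi> x) / e)"
      if "h \<in> ball 0 e - {0}" for h
      unfolding norm_mult[of "g _"] using that \<phi>
      by (intro AE_I2 mult_left_mono norm_exp_difference_quotient_le) auto
    show "AE x in M. ((\<lambda>h. g x * ((?E (p + h) x - ?E p x) / h)) \<longlongrightarrow> g x * (- of_real (\<phi> x) * ?E p x))
        (at 0 within ball 0 e)"
      by (intro AE_I2 tendsto_mult_left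
        tendsto_within_subset[OF tendsto_exp_difference_quotient]) simp
  qed measurable
  moreover have "(\<integral>x. g x * ((?E (p + h) x - ?E p x) / h) \<partial>M)
      = ((\<integral>x. g x * ?E (p + h) x \<partial>M) - (\<integral>x. g x * ?E p x \<partial>M)) / h"
    if "norm h < e" for h
  proof -
    have "Re (p + h) > c0"
      using that abs_Re_le_cmod[of h] e by auto
    then show ?thesis
      using int'[of "p + h"] int'[OF p] by (simp add: right_diff_distrib)
  qed
  then have "\<forall>\<^sub>F h in at 0 within ball 0 e. (\<integral>x. g x * ((?E (p + h) x - ?E p x) / h) \<partial>M)
      = ((\<integral>x. g x * ?E (p + h) x \<partial>M) - (\<integral>x. g x * ?E p x \<partial>M)) / h"
    unfolding eventually_at_filter by (intro always_eventually allI impI)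
      (simp only: mem_ball dist_0_norm)
  ultimately have "((\<lambda>h. ((\<integral>x. g x * ?E (p + h) x \<partial>M) - (\<integral>x. g x * ?E p x \<partial>M)) / h)
      \<longlongrightarrow> (\<integral>x. - of_real (\<phi> x) * g x * ?E p x \<partial>M)) (at 0 within ball 0 e)"
    by (auto simp: mult_ac intro: Lim_transform_eventually)
  then show ?thesis
    using e unfolding DERIV_def by (subst (asm) at_within_open) auto
qed

subsection \<open>Integrals of powers against exponentials of powers\<close>

lemma Gamma_absolute_integral:
  assumes "a > (0::real)"
  shows "(\<lambda>t. t powr (a - 1) / exp t) absolutely_integrable_on {0<..}"
    and "integral {0<..} (\<lambda>t. t powr (a - 1) / exp t) = Gamma a"
proof -
  have *: "((\<lambda>t. t powr (a - 1) / exp t) has_integral Gamma a) {0<..}"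
    using Gamma_integral_real[OF assms]
    by (subst has_integral_spike_set_eq[where T = "{0..}"])
      (auto intro: negligible_subset[of "{0}"])
  then show "integral {0<..} (\<lambda>t. t powr (a - 1) / exp t) = Gamma a"
    by (rule integral_unique)
  from * show "(\<lambda>t. t powr (a - 1) / exp t) absolutely_integrable_on {0<..}"
    by (intro nonnegative_absolutely_integrable_1) (auto simp: integrable_on_def)
qed

lemma bij_betw_mult_powr:
  fixes d p :: real
  assumes d: "d > 0" and p: "p > 0"
  shows "bij_betw (\<lambda>x. p * x powr d) {0<..} {0<..}"
  by (rule bij_betw_byWitness[where f' = "\<lambda>y. (y / p) powr (1 / d)"])
     (use d p in \<open>auto simp: powr_powr\<close>)

lemma powr_exp_powr_absolute_integral:
  fixes c d p :: real
  assumes c: "c > -1" and d: "d > 0" and p: "p > 0"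
  defines "a \<equiv> (c + 1) / d"
  shows "(\<lambda>x. x powr c * exp (- p * x powr d)) absolutely_integrable_on {0<..}"
    and "integral {0<..} (\<lambda>x. x powr c * exp (- p * x powr d)) = Gamma a * p powr - a / d"
proof -
  have a: "a > 0" "d * a = c + 1" using c d by (auto simp: a_def)
  let ?y = "\<lambda>x::real. p * x powr d" and ?f = "\<lambda>x. x powr c * exp (- p * x powr d)"
  have y: "inj_on ?y {0<..}" "?y ` {0<..} = {0<..}"
    using bij_betw_mult_powr[OF d p] by (auto simp: bij_betw_def)
  have substituted: "(\<lambda>x. \<bar>p * (d * x powr (d - 1))\<bar>
      * (?y x powr (a - 1) / exp (?y x))) absolutely_integrable_on {0<..}
      \<and> integral {0<..} (\<lambda>x. \<bar>p * (d * x powr (d - 1))\<bar> * (?y x powr (a - 1) / exp (?y x)))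
        = Gamma a"
    by (subst has_absolute_integral_change_of_variables_1'[where g = ?y])
       (use Gamma_absolute_integral[OF a(1)] y in \<open>auto intro!: derivative_eq_intros\<close>)
  have integrand: "\<bar>p * (d * x powr (d - 1))\<bar> * (?y x powr (a - 1) / exp (?y x))
      = (d * p powr a) * ?f x"
    if "x \<in> {0<..}" for x
  proof -
    have "x powr (d - 1) * (x powr d) powr (a - 1) = x powr c"
      using a by (simp add: powr_powr algebra_simps flip: powr_add)
    moreover have "p * p powr (a - 1) = p powr a"
      using p by (simp add: powr_mult_base)
    ultimately show ?thesis using that p d
      by (simp add: powr_mult abs_mult exp_minus field_simps)
  qed
  have "(\<lambda>x. (d * p powr a) * ?f x) absolutely_integrable_on {0<..}"
    using substituted by (subst set_integrable_cong[OF refl refl integrand[symmetric]]) auto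
  moreover have "integral {0<..} (\<lambda>x. (d * p powr a) * ?f x) = Gamma a"
    using substituted by (subst Henstock_Kurzweil_Integration.integral_cong[OF integrand[symmetric]]) auto
  ultimately have "?f absolutely_integrable_on {0<..}"
    "(d * p powr a) * integral {0<..} ?f = Gamma a"
    using set_integrable_mult_right_iff[of "d * p powr a"] d p by simp_all
  then show "?f absolutely_integrable_on {0<..}" and "integral {0<..} ?f = Gamma a * p powr - a / d"
    using d p by (auto simp: powr_minus field_simps)
qed

lemma has_bochner_integral_powr_exp_powr:
  fixes c d p :: real
  assumes "c > -1" and "d > 0" and "p > 0"
  defines "a \<equiv> (c + 1) / d"
  shows "has_bochner_integral lborel (\<lambda>x. \<bar>x\<bar> powr c * exp (- p * \<bar>x\<bar> powr d))
      (2 / d * Gamma a * p powr - a)"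
proof -
  let ?f = "\<lambda>x. x powr c * exp (- p * x powr d)"
  note half = powr_exp_powr_absolute_integral[OF assms(1-3), folded a_def]
  have int: "set_integrable lborel {0<..} ?f"
    using half(1) unfolding set_integrable_def by (subst (asm) integrable_completion) auto
  then have "has_bochner_integral lborel (\<lambda>x. indicator {0<..} x *\<^sub>R ?f x) (Gamma a * p powr - a / d)"
    using set_borel_integral_eq_integral(2)[OF int] half(2)
    by (simp add: has_bochner_integral_iff set_integrable_def set_lebesgue_integral_def)
  then have "has_bochner_integral lborel (\<lambda>x. indicator {0..} x *\<^sub>R (\<bar>x\<bar> powr c * exp (- p * \<bar>x\<bar> powr d)))
      (Gamma a * p powr - a / d)"
    by (rule has_bochner_integral_cong[THEN iffD1, rotated -1]) (auto split: split_indicator)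
  from has_bochner_integral_even_function[OF this] show ?thesis by (simp add: mult.assoc)
qed

subsection \<open>Difference quotients\<close>

lemma has_vector_derivative_iff_difference_quotient:
  fixes f :: "real \<Rightarrow> 'a::real_normed_vector"
  shows "(f has_vector_derivative D) (at x within S) \<longleftrightarrow>
    ((\<lambda>y. (f y - f x) /\<^sub>R (y - x)) \<longlongrightarrow> D) (at x within S)"
proof -
  have "norm (f y - f x - (y - x) *\<^sub>R D) / norm (y - x) = norm ((f y - f x) /\<^sub>R (y - x) - D)"
    if "y \<noteq> x" for y
  proof -
    have "(f y - f x) /\<^sub>R (y - x) - D = (f y - f x - (y - x) *\<^sub>R D) /\<^sub>R (y - x)"
      using that by (simp add: scaleR_diff_right)
    then show ?thesis by (simp add: divide_inverse_commute)
  qed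
  then have "((\<lambda>y. norm (f y - f x - (y - x) *\<^sub>R D) / norm (y - x)) \<longlongrightarrow> 0) (at x within S)
      \<longleftrightarrow> ((\<lambda>y. norm ((f y - f x) /\<^sub>R (y - x) - D)) \<longlongrightarrow> 0) (at x within S)"
    by (intro tendsto_cong) (auto simp: eventually_at_filter)
  then show ?thesis
    by (simp add: has_vector_derivative_def has_derivative_iff_norm bounded_linear_scaleR_left
        tendsto_norm_zero_iff LIM_zero_iff)
qed

section \<open>Square-integrable functions and Gaussians\<close>

lemma memL_2_iff:
  "memL k n 2 f \<longleftrightarrow> f \<in> borel_measurable (mu_kn k n) \<and> integrable (mu_kn k n) (\<lambda>x. (norm (f x))\<^sup>2)"
proof -
  have "norm (f x) powr 2 = (norm (f x))\<^sup>2" for x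
    by (cases "f x = 0") auto
  then show ?thesis by (simp add: memL_def)
qed

lemma memL_2_add:
  assumes "memL k n 2 f" "memL k n 2 g"
  shows "memL k n 2 (\<lambda>x. f x + g x)"
proof -
  have [measurable]: "f \<in> borel_measurable (mu_kn k n)" "g \<in> borel_measurable (mu_kn k n)"
    and int: "integrable (mu_kn k n) (\<lambda>x. 2 * (norm (f x))\<^sup>2 + 2 * (norm (g x))\<^sup>2)"
    using assms by (auto simp: memL_2_iff)
  have "(norm (a + b))\<^sup>2 \<le> 2 * (norm a)\<^sup>2 + 2 * (norm b)\<^sup>2" for a b :: complex
  proof -
    have "(norm (a + b))\<^sup>2 \<le> (norm a + norm b)\<^sup>2"
      by (intro power_mono norm_triangle_ineq) auto
    also have "\<dots> \<le> 2 * (norm a)\<^sup>2 + 2 * (norm b)\<^sup>2"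
      using sum_squares_bound[of "norm a" "norm b"] by (simp add: power2_sum)
    finally show ?thesis .
  qed
  then have "integrable (mu_kn k n) (\<lambda>x. (norm (f x + g x))\<^sup>2)"
    by (intro Bochner_Integration.integrable_bound[OF int]) (auto intro!: AE_I2)
  then show ?thesis by (auto simp: memL_2_iff)
qed

lemma memL_2_cmult: "memL k n 2 f \<Longrightarrow> memL k n 2 (\<lambda>x. c * f x)"
  by (auto simp: memL_2_iff norm_mult power_mult_distrib)

lemma memL_2_diff:
  assumes "memL k n 2 f" "memL k n 2 g"
  shows "memL k n 2 (\<lambda>x. f x - g x)"
  using memL_2_add[OF assms(1) memL_2_cmult[OF assms(2), of "-1"]] by simp

lemma memL_2_dominated:
  assumes "memL k n 2 f" "g \<in> borel_measurable (mu_kn k n)" "\<And>x. norm (g x) \<le> norm (f x)"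
  shows "memL k n 2 g"
  using assms unfolding memL_2_iff
  by (auto intro!: Bochner_Integration.integrable_bound[of _
      "\<lambda>x. (norm (f x))\<^sup>2" "\<lambda>x. (norm (g x))\<^sup>2"] AE_I2 power_mono)

lemma L2norm_nonneg: "L2norm k n f \<ge> 0"
  by (simp add: L2norm_def)

locale generalized_fourier =
  fixes k :: real and n :: nat
  assumes n_ge_1: "n \<ge> 1" and k_ge: "k \<ge> (real n - 1) / (2 * real n)"
begin

abbreviation \<mu> where "\<mu> \<equiv> mu_kn k n"
abbreviation \<alpha> where "\<alpha> \<equiv> alpha_kn k n"

lemma n_pos: "real n > 0"
  using n_ge_1 by simp

lemma alpha_ge: "\<alpha> \<ge> - 1 / 2"
  using k_ge n_pos by (simp add: alpha_kn_def field_simps)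

lemma Gamma_alpha_pos: "Gamma (\<alpha> + 1) > 0"
  using alpha_ge by (intro Gamma_real_pos) simp

subsection \<open>The measure\<close>

definition weight :: "real \<Rightarrow> real" where
  "weight x = (real n / 2) powr \<alpha> / (2 * Gamma (\<alpha> + 1)) * \<bar>x\<bar> powr (2 * k + 2 / real n - 2)"

lemma mu_eq_density: "\<mu> = density lborel weight"
  by (simp add: mu_kn_def weight_def)

lemma weight_measurable [measurable]: "weight \<in> borel_measurable borel"
  unfolding weight_def by measurable

lemma weight_nonneg: "weight x \<ge> 0"
  using Gamma_alpha_pos by (simp add: weight_def)

lemma weight_eq_0_iff: "weight x = 0 \<longleftrightarrow> x = 0"
  using Gamma_alpha_pos n_pos by (simp add: weight_def)

lemma weight_minus: "weight (- x) = weight x"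
  by (simp add: weight_def)

lemma sets_mu [simp, measurable_cong]: "sets \<mu> = sets borel"
  by (simp add: mu_kn_def)

lemma space_mu [simp]: "space \<mu> = UNIV"
  by (simp add: mu_kn_def)

lemma borel_measurable_mu [simp]: "borel_measurable \<mu> = borel_measurable borel"
  by (rule measurable_cong_sets) auto

lemma sigma_finite_mu: "sigma_finite_measure \<mu>"
  unfolding mu_eq_density
  by (subst sigma_finite_measure.sigma_finite_iff_density_finite[OF sigma_finite_lborel]) auto

lemma AE_mu_nonzero: "AE x in \<mu>. x \<noteq> 0"
  unfolding mu_eq_density by (subst AE_density) (auto simp: less_le weight_nonneg weight_eq_0_iff)

lemma distr_mu_uminus: "distr \<mu> borel uminus = \<mu>"
  using density_distr[of weight borel uminus lborel]
  by (simp add: mu_eq_density weight_minus lborel_distr_uminus)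

lemma integral_mu_reflect:
  fixes f :: "real \<Rightarrow> 'b::{banach,second_countable_topology}"
  assumes "f \<in> borel_measurable borel"
  shows "(\<integral>x. f (- x) \<partial>\<mu>) = (\<integral>x. f x \<partial>\<mu>)"
  using integral_distr[of uminus \<mu> borel f] assms by (simp add: distr_mu_uminus)

lemma integrable_mu_reflect:
  fixes f :: "real \<Rightarrow> 'b::{banach,second_countable_topology}"
  assumes "integrable \<mu> f"
  shows "integrable \<mu> (\<lambda>x. f (- x))"
  using integrable_distr_eq[of uminus \<mu> borel f] assms borel_measurable_integrable[OF assms]
  by (simp add: distr_mu_uminus)

lemma integral_mu_odd:
  fixes f :: "real \<Rightarrow> 'b::{banach,second_countable_topology}"
  assumes "f \<in> borel_measurable borel" and odd: "\<And>x. f (- x) = - f x"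
  shows "(\<integral>x. f x \<partial>\<mu>) = 0"
proof -
  have "(\<integral>x. f x \<partial>\<mu>) = - (\<integral>x. f x \<partial>\<mu>)"
    using integral_mu_reflect[OF assms(1)] by (simp add: odd)
  then have "2 *\<^sub>R (\<integral>x. f x \<partial>\<mu>) = 0"
    by (metis add.right_inverse scaleR_2)
  then show ?thesis by simp
qed

subsection \<open>Radial moments\<close>

definition rad :: "real \<Rightarrow> real" where "rad x = \<bar>x\<bar> powr (2 / real n)"

definition rad_inverse :: "real \<Rightarrow> real" where "rad_inverse r = r powr (real n / 2)"

lemma rad_measurable [measurable]: "rad \<in> borel_measurable borel"
  unfolding rad_def by measurable

lemma rad_nonneg [simp]: "rad x \<ge> 0"
  by (simp add: rad_def)

lemma rad_minus [simp]: "rad (- x) = rad x"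
  by (simp add: rad_def)

lemma rad_mono: "\<bar>x\<bar> \<le> \<bar>y\<bar> \<Longrightarrow> rad x \<le> rad y"
  unfolding rad_def by (intro powr_mono2) auto

lemma rad_inverse_rad: "rad_inverse (rad x) = \<bar>x\<bar>"
  using n_pos by (simp add: rad_def rad_inverse_def powr_powr)

definition moment :: "real \<Rightarrow> real \<Rightarrow> real" where
  "moment a p = (real n / 2) powr (\<alpha> + 1) / Gamma (\<alpha> + 1) * Gamma a * p powr - a"

lemma moment_scale: "moment a p = moment a 1 * p powr - a"
  by (simp add: moment_def)

lemma moment_pos: "a > 0 \<Longrightarrow> p > 0 \<Longrightarrow> moment a p > 0"
  using Gamma_alpha_pos n_pos by (simp add: moment_def)

lemma has_bochner_integral_powr_exp_rad:
  assumes p: "p > 0" and b: "b \<ge> 0"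
  shows "has_bochner_integral \<mu> (\<lambda>x. \<bar>x\<bar> powr b * exp (- p * rad x))
      (moment (\<alpha> + 1 + b * real n / 2) p)"
proof -
  define C where "C = (real n / 2) powr \<alpha> / (2 * Gamma (\<alpha> + 1))"
  define e where "e = 2 * k + 2 / real n - 2"
  define a where "a = \<alpha> + 1 + b * real n / 2"
  have a: "(e + b + 1) / (2 / real n) = a"
    using n_pos by (simp add: e_def a_def alpha_kn_def field_simps)
  have "e + b > -1"
  proof -
    have "a > 0" using alpha_ge b by (simp add: a_def add_pos_nonneg)
    then show ?thesis using n_pos by (simp add: a[symmetric] zero_less_mult_iff)
  qed
  then have "has_bochner_integral lborel (\<lambda>x. \<bar>x\<bar> powr (e + b) * exp (- p * \<bar>x\<bar> powr (2 / real n)))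
      (2 / (2 / real n) * Gamma a * p powr - a)"
    unfolding a[symmetric] using p n_pos by (intro has_bochner_integral_powr_exp_powr) auto
  then have "has_bochner_integral lborel (\<lambda>x. C * (\<bar>x\<bar> powr (e + b) * exp (- p * rad x)))
      (C * (real n * Gamma a * p powr - a))"
    unfolding rad_def by (intro has_bochner_integral_mult_right) simp
  also have "(\<lambda>x. C * (\<bar>x\<bar> powr (e + b) * exp (- p * rad x)))
      = (\<lambda>x. weight x *\<^sub>R (\<bar>x\<bar> powr b * exp (- p * rad x)))"
    by (simp add: weight_def C_def e_def powr_add fun_eq_iff)
  also have "C * (real n * Gamma a * p powr - a) = moment a p"
    using n_pos by (simp add: C_def moment_def powr_add)
  finally show ?thesis
    unfolding mu_eq_density a_def[symmetric]
    by (intro has_bochner_integral_density) (auto intro: AE_I2 weight_nonneg)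
qed

subsection \<open>Gaussians\<close>

definition gauss :: "nat \<Rightarrow> real \<Rightarrow> real \<Rightarrow> real" where
  "gauss j p x = x ^ j * exp (- p * rad x)"

definition cgauss :: "nat \<Rightarrow> complex \<Rightarrow> real \<Rightarrow> complex" where
  "cgauss j p x = of_real (x ^ j) * exp (- p * of_real (rad x))"

lemma gauss_measurable [measurable]: "gauss j p \<in> borel_measurable borel"
  unfolding gauss_def by measurable

lemma cgauss_measurable [measurable]: "cgauss j p \<in> borel_measurable borel"
  unfolding cgauss_def by measurable

lemma cgauss_of_real: "cgauss j (of_real p) x = of_real (gauss j p x)"
  by (simp add: cgauss_def gauss_def flip: exp_of_real)

lemma norm_cgauss: "norm (cgauss j p x) = \<bar>gauss j (Re p) x\<bar>"
  by (simp add: cgauss_def gauss_def norm_mult abs_mult norm_power power_abs)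

lemma gauss_mult: "gauss i p x * gauss j q x = gauss (i + j) (p + q) x"
  by (simp add: gauss_def power_add algebra_simps flip: exp_add)

lemma gauss_even_nonneg: "gauss (2 * j) p x \<ge> 0"
  by (simp add: gauss_def)

lemma abs_gauss_mult: "\<bar>gauss j p x\<bar> * \<bar>gauss j q x\<bar> = gauss (2 * j) (p + q) x"
  using gauss_even_nonneg[of j "p + q" x] unfolding abs_mult[symmetric] gauss_mult
  by (simp add: mult_2)

lemma gauss_minus: "gauss j p (- x) = (- 1) ^ j * gauss j p x"
  by (simp add: gauss_def power_minus[of x])

lemma cgauss_minus: "cgauss j p (- x) = (- 1) ^ j * cgauss j p x"
  by (simp add: cgauss_def power_minus[of "complex_of_real x"])

lemma gauss_eq_0_iff: "gauss j p x = 0 \<longleftrightarrow> j \<noteq> 0 \<and> x = 0"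
  by (auto simp: gauss_def)

definition \<beta> :: "nat \<Rightarrow> real" where "\<beta> j = \<alpha> + real j * real n"

lemma beta_ge: "\<beta> j \<ge> - 1 / 2"
proof -
  have "real j * real n \<ge> 0" by simp
  then show ?thesis using alpha_ge unfolding \<beta>_def by linarith
qed

lemma beta_plus_1_pos: "\<beta> j + 1 > 0"
  using beta_ge[of j] by linarith

lemma rad_abs_gauss_moment:
  assumes p: "p > 0"
  shows "has_bochner_integral \<mu> (\<lambda>x. rad x ^ m * \<bar>gauss i p x\<bar>)
    (moment (\<alpha> + 1 + real i * real n / 2 + real m) p)"
proof -
  define b where "b = real i + 2 * real m / real n"
  have b: "b \<ge> 0" "b * real n / 2 = real i * real n / 2 + real m"
    using n_pos by (simp_all add: b_def field_simps)
  have "AE x in \<mu>. \<bar>x\<bar> powr b * exp (- p * rad x) = rad x ^ m * \<bar>gauss i p x\<bar>"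
    using AE_mu_nonzero
  proof eventually_elim
    case (elim x)
    then have "\<bar>x\<bar> powr b = rad x ^ m * \<bar>x\<bar> ^ i"
      by (simp add: b_def powr_add rad_def powr_powr flip: powr_realpow)
    then show ?case by (simp add: gauss_def abs_mult power_abs)
  qed
  then show ?thesis
    using has_bochner_integral_powr_exp_rad[OF p b(1)] unfolding b
    by (subst has_bochner_integral_cong_AE[symmetric]) (auto simp: add.assoc)
qed

lemma rad_gauss_moment:
  assumes "p > 0"
  shows "has_bochner_integral \<mu> (\<lambda>x. rad x ^ m * gauss (2 * j) p x) (moment (\<beta> j + 1 + real m) p)"
  using rad_abs_gauss_moment[OF assms, of m "2 * j"] by (simp add: gauss_even_nonneg \<beta>_def add_ac)

lemma gauss_moment:
  assumes "p > 0"
  shows "has_bochner_integral \<mu> (gauss (2 * j) p) (moment (\<beta> j + 1) p)"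
  using rad_gauss_moment[OF assms, of 0] by simp

lemma gauss_inner:
  assumes "p + q > 0"
  shows "has_bochner_integral \<mu> (\<lambda>x. gauss j p x * gauss j q x) (moment (\<beta> j + 1) (p + q))"
  using gauss_moment[OF assms, of j] unfolding gauss_mult by (simp add: mult_2)

lemma cgauss_square_integral:
  assumes "Re p > 0"
  shows "has_bochner_integral \<mu> (\<lambda>x. (norm (cgauss j p x))\<^sup>2) (moment (\<beta> j + 1) (2 * Re p))"
  using gauss_inner[of "Re p" "Re p" j] assms by (simp add: norm_cgauss power2_eq_square)

subsection \<open>Gaussian pairings\<close>

definition gauss_pair :: "nat \<Rightarrow> (real \<Rightarrow> complex) \<Rightarrow> complex \<Rightarrow> complex" where
  "gauss_pair j f p = (\<integral>x. f x * cgauss j p x \<partial>\<mu>)"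

lemma gauss_pair_integrable:
  assumes f: "memL k n 2 f" and p: "Re p > 0"
  shows "integrable \<mu> (\<lambda>x. f x * cgauss j p x)"
  using f cgauss_square_integral[OF p, of j]
  by (intro integrable_mult_if_square_integrable) (auto simp: memL_2_iff has_bochner_integral_iff)

lemma abs_gauss_integrable:
  assumes f: "memL k n 2 f" and p: "p > 0"
  shows "integrable \<mu> (\<lambda>x. norm (f x) * \<bar>gauss j p x\<bar>)"
  using integrable_norm[OF gauss_pair_integrable[OF f, of "of_real p" j]] p
  by (simp add: norm_mult norm_cgauss)

lemma gauss_pair_bound:
  assumes f: "memL k n 2 f" and p: "Re p > 0"
  shows "norm (gauss_pair j f p) \<le> L2norm k n f * sqrt (moment (\<beta> j + 1) (2 * Re p))"
  using Cauchy_Schwarz_integral[of f \<mu> "cgauss j p"] f cgauss_square_integral[OF p, of j]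
  by (simp add: gauss_pair_def L2norm_def memL_2_iff has_bochner_integral_iff)

lemma gauss_pair_add:
  assumes "memL k n 2 f" "memL k n 2 g" "Re p > 0"
  shows "gauss_pair j (\<lambda>x. f x + g x) p = gauss_pair j f p + gauss_pair j g p"
  using gauss_pair_integrable[OF assms(1,3), of j] gauss_pair_integrable[OF assms(2,3), of j]
  by (simp add: gauss_pair_def distrib_right)

lemma gauss_pair_cmult: "gauss_pair j (\<lambda>x. c * f x) p = c * gauss_pair j f p"
  by (simp add: gauss_pair_def mult.assoc)

lemma gauss_pair_diff:
  assumes "memL k n 2 f" "memL k n 2 g" "Re p > 0"
  shows "gauss_pair j (\<lambda>x. f x - g x) p = gauss_pair j f p - gauss_pair j g p"
  using gauss_pair_add[OF assms(1) memL_2_cmult[OF assms(2), of "-1"] assms(3)]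
    gauss_pair_cmult[of j "-1"] by simp

lemma gauss_pair_cong_AE:
  assumes "AE x in \<mu>. f x = g x" "f \<in> borel_measurable borel" "g \<in> borel_measurable borel"
  shows "gauss_pair j f p = gauss_pair j g p"
  unfolding gauss_pair_def using assms by (intro integral_cong_AE) auto

lemma gauss_pair_has_field_derivative:
  assumes [measurable]: "f \<in> borel_measurable borel"
    and int: "\<And>c. c > c0 \<Longrightarrow> integrable \<mu> (\<lambda>x. norm (f x) * \<bar>gauss j c x\<bar>)"
    and p: "Re p > c0"
  shows "(gauss_pair j f has_field_derivative gauss_pair j (\<lambda>x. - of_real (rad x) * f x) p) (at p)"
proof -
  have "integrable \<mu> (\<lambda>x. norm (f x * of_real (x ^ j)) * exp (- c * rad x))" if "c > c0" for c
    using int[OF that] by (simp add: norm_mult norm_power gauss_def abs_mult power_abs mult.assoc)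
  then have "((\<lambda>p. \<integral>x. (f x * of_real (x ^ j)) *
      exp (- p * of_real (rad x)) \<partial>\<mu>) has_field_derivative
      (\<integral>x. - of_real (rad x) * (f x * of_real (x ^ j)) * exp (- p * of_real (rad x)) \<partial>\<mu>)) (at p)"
    using p by (intro has_field_derivative_Laplace) auto
  then show ?thesis
    by (simp add: gauss_pair_def[abs_def] cgauss_def mult.assoc)
qed

lemma gauss_pair_holomorphic:
  assumes "f \<in> borel_measurable borel"
    and "\<And>c. c > c0 \<Longrightarrow> integrable \<mu> (\<lambda>x. norm (f x) * \<bar>gauss j c x\<bar>)"
  shows "gauss_pair j f holomorphic_on {p. Re p > c0}"
  using gauss_pair_has_field_derivative[OF assms]
  by (auto simp: holomorphic_on_open[OF open_halfspace_Re_gt])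

end

section \<open>Bessel functions\<close>

definition bessel_coeff :: "real \<Rightarrow> nat \<Rightarrow> real" where
  "bessel_coeff b m = (- 1) ^ m * Gamma (b + 1) / (fact m * Gamma (b + real m + 1))"

lemma even_powers_sums_cosh: "(\<lambda>m. z ^ (2 * m) / fact (2 * m)) sums cosh (z :: real)"
proof -
  have "(\<lambda>m. if even (2 * m) then z ^ (2 * m) /\<^sub>R fact (2 * m) else 0) sums cosh z"
    using cosh_converges[of z]
    by (subst sums_mono_reindex[of "\<lambda>m. 2 * m" "\<lambda>m. if even m then z ^ m /\<^sub>R fact m else 0"])
       (auto simp: strict_mono_def elim!: evenE)
  then show ?thesis by (simp add: divide_inverse mult.commute)
qed

context
  fixes b :: real
  assumes b: "b \<ge> - 1 / 2"
begin

lemma Gamma_bessel_pos: "Gamma (b + real m + 1) > 0"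
  using b by (intro Gamma_real_pos) auto

text \<open>The extremal case \<open>b = - 1 / 2\<close> is the cosine, where this is an equality.\<close>

lemma bessel_term_bound: "\<bar>bessel_coeff b m * (z / 2) ^ (2 * m)\<bar> \<le> z ^ (2 * m) / fact (2 * m)"
proof -
  have nonpole: "b + 1 \<notin> \<int>\<^sub>\<le>\<^sub>0"
    using b nonpos_Ints_nonpos by fastforce
  have "pochhammer (1 / 2) m \<le> pochhammer (b + 1) m"
    unfolding pochhammer_prod using b by (intro prod_mono) auto
  also have "\<dots> = Gamma (b + real m + 1) / Gamma (b + 1)"
    using pochhammer_Gamma[OF nonpole, of m] by (simp add: add_ac)
  finally have "fact (2 * m) \<le> 2 ^ (2 * m) * (Gamma (b + real m + 1) / Gamma (b + 1)) * fact m"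
    unfolding fact_double by (intro mult_right_mono mult_left_mono) auto
  then have "z ^ (2 * m) * fact (2 * m)
      \<le> z ^ (2 * m) * (2 ^ (2 * m) * (Gamma (b + real m + 1) / Gamma (b + 1)) * fact m)"
    by (rule mult_left_mono) auto
  then show ?thesis
    using Gamma_bessel_pos[of 0] Gamma_bessel_pos[of m]
    by (simp add: bessel_coeff_def abs_mult power_abs power_divide power_even_abs field_simps)
qed

lemma bessel_abs_summable: "summable (\<lambda>m. \<bar>bessel_coeff b m * (z / 2) ^ (2 * m)\<bar>)"
  by (rule summable_comparison_test'[OF sums_summable[OF even_powers_sums_cosh[of z]]])
     (use bessel_term_bound in simp)

lemma bessel_j_sums: "(\<lambda>m. bessel_coeff b m * (z / 2) ^ (2 * m)) sums bessel_j b z"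
proof -
  have eq: "bessel_coeff b m * (z / 2) ^ (2 * m)
     = Gamma (b + 1) * ((- 1) ^ m / (fact m * Gamma (b + real m + 1)) * (z / 2) ^ (2 * m))" for m
    by (simp add: bessel_coeff_def)
  have "summable (\<lambda>m. (- 1) ^ m / (fact m * Gamma (b + real m + 1)) * (z / 2) ^ (2 * m))"
    using summable_rabs_cancel[OF bessel_abs_summable, of z] Gamma_bessel_pos[of 0]
    unfolding eq by (subst (asm) summable_cmult_iff) auto
  then show ?thesis
    unfolding bessel_j_def eq by (intro sums_mult summable_sums)
qed

lemma bessel_j_bound: "\<bar>bessel_j b z\<bar> \<le> exp \<bar>z\<bar>"
proof -
  have "\<bar>bessel_j b z\<bar> \<le> (\<Sum>m. \<bar>bessel_coeff b m * (z / 2) ^ (2 * m)\<bar>)"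
    unfolding sums_unique[OF bessel_j_sums] by (rule summable_rabs[OF bessel_abs_summable])
  also have "\<dots> \<le> (\<Sum>m. z ^ (2 * m) / fact (2 * m))"
    by (intro suminf_le bessel_term_bound bessel_abs_summable sums_summable[OF even_powers_sums_cosh])
  also have "\<dots> = cosh z"
    by (rule sums_unique[symmetric, OF even_powers_sums_cosh])
  also have "\<dots> \<le> exp \<bar>z\<bar>"
    by (cases "z \<ge> 0") (simp_all add: cosh_def)
  finally show ?thesis .
qed

lemma isCont_bessel_j: "isCont (bessel_j b) z"
proof -
  have "summable (\<lambda>m. bessel_coeff b m * y ^ m)" for y
    by (rule summable_rabs_cancel,
      rule summable_comparison_test'[OF bessel_abs_summable[of "2 * sqrt \<bar>y\<bar>"]])
       (simp add: abs_mult power_mult power_abs)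
  then have "isCont (\<lambda>y. \<Sum>m. bessel_coeff b m * y ^ m) ((z / 2)\<^sup>2)"
    by (rule isCont_powser_converges_everywhere)
  then have "isCont (\<lambda>z. \<Sum>m. bessel_coeff b m * ((z / 2)\<^sup>2) ^ m) z"
    by (rule isCont_o2[rotated]) auto
  moreover have "(\<Sum>m. bessel_coeff b m * ((z / 2)\<^sup>2) ^ m) = bessel_j b z" for z
    unfolding sums_unique[OF bessel_j_sums] by (simp add: power_mult)
  ultimately show ?thesis by simp
qed

end

lemma bessel_j_measurable [measurable]: "bessel_j b \<in> borel_measurable borel"
  unfolding bessel_j_def[abs_def] by measurable

section \<open>The Hankel-type components of the kernel\<close>

lemma has_bochner_integral_sums:
  fixes f :: "nat \<Rightarrow> 'a \<Rightarrow> 'b::{banach,second_countable_topology}"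
  assumes f: "\<And>m. has_bochner_integral M (f m) (I m)"
    and pointwise: "\<And>x. (\<lambda>m. f m x) sums g x" "\<And>x. summable (\<lambda>m. norm (f m x))"
    and norms: "summable (\<lambda>m. \<integral>x. norm (f m x) \<partial>M)" and I: "I sums S"
  shows "has_bochner_integral M g S"
proof -
  have int: "integrable M (f m)" for m using f by (simp add: has_bochner_integral_iff)
  have g: "g = (\<lambda>x. \<Sum>m. f m x)" using pointwise(1) by (auto simp: sums_iff)
  have "integrable M g"
    unfolding g by (intro integrable_suminf int AE_I2 pointwise norms)
  moreover have "(\<lambda>m. \<integral>x. f m x \<partial>M) sums (\<integral>x. g x \<partial>M)"
    unfolding g by (intro sums_integral int AE_I2 pointwise norms)
  then have "(\<integral>x. g x \<partial>M) = S"
    using I f by (simp add: has_bochner_integral_iff sums_unique2)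
  ultimately show ?thesis by (simp add: has_bochner_integral_iff)
qed

lemma (in pair_sigma_finite) integrable_product_dominated:
  fixes g :: "'a \<times> 'b \<Rightarrow> 'c::{banach,second_countable_topology}" and A B :: "_ \<Rightarrow> real"
  assumes A: "integrable M1 A" and B: "integrable M2 B" and g: "g \<in> borel_measurable (M1 \<Otimes>\<^sub>M M2)"
    and bound: "\<And>x y. norm (g (x, y)) \<le> A x * B y"
  shows "integrable (M1 \<Otimes>\<^sub>M M2) g"
proof (rule Bochner_Integration.integrable_bound[OF _ g])
  have [measurable]: "A \<in> borel_measurable M1" "B \<in> borel_measurable M2" using A B by auto
  show "integrable (M1 \<Otimes>\<^sub>M M2) (\<lambda>(x, y). A x * B y)"
  proof (rule Fubini_integrable)
    show "integrable M1 (\<lambda>x. \<integral>y. norm (case (x, y) of (x, y) \<Rightarrow> A x * B y) \<partial>M2)"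
      using A by (simp add: abs_mult)
    show "AE x in M1. integrable M2 (\<lambda>y. case (x, y) of (x, y) \<Rightarrow> A x * B y)"
      using B by simp
  qed measurable
  show "AE z in M1 \<Otimes>\<^sub>M M2. norm (g z) \<le> norm (case z of (x, y) \<Rightarrow> A x * B y)"
    by (intro AE_I2) (auto intro: order.trans[OF bound])
qed

context generalized_fourier
begin

sublocale mu_pair: pair_sigma_finite \<mu> \<mu>
  by (intro pair_sigma_finite.intro sigma_finite_mu)

definition hankel_kernel :: "nat \<Rightarrow> real \<Rightarrow> real \<Rightarrow> real" where
  "hankel_kernel j x \<xi> = (x * \<xi>) ^ j * bessel_j (\<beta> j) (real n * \<bar>\<xi> * x\<bar> powr (1 / real n))"

definition dual :: "real \<Rightarrow> real" where "dual s = (real n)\<^sup>2 / (4 * s)"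

lemma dual_pos: "s > 0 \<Longrightarrow> dual s > 0"
  using n_pos by (simp add: dual_def)

lemma dual_dual: "s > 0 \<Longrightarrow> dual (dual s) = s"
  using n_pos by (simp add: dual_def field_simps)

lemma hankel_kernel_measurable [measurable]:
  assumes [measurable]: "a \<in> borel_measurable M" "b \<in> borel_measurable M"
  shows "(\<lambda>p. hankel_kernel j (a p) (b p)) \<in> borel_measurable M"
  unfolding hankel_kernel_def by measurable

lemma bessel_argument:
  "real n * \<bar>\<xi> * x\<bar> powr (1 / real n) = real n * sqrt (rad x) * sqrt (rad \<xi>)"
  by (simp add: rad_def abs_mult powr_mult powr_powr flip: powr_half_sqrt)

lemma bessel_argument_power:
  "(real n * \<bar>\<xi> * x\<bar> powr (1 / real n) / 2) ^ (2 * m) = ((real n)\<^sup>2 / 4 * rad x * rad \<xi>) ^ m"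
  unfolding bessel_argument by (simp add: power_mult power_divide power_mult_distrib)

definition hankel_coeff :: "nat \<Rightarrow> real \<Rightarrow> nat \<Rightarrow> real" where
  "hankel_coeff j x m = bessel_coeff (\<beta> j) m * ((real n)\<^sup>2 / 4 * rad x) ^ m * x ^ j"

lemma hankel_kernel_gauss_term:
  "hankel_coeff j x m * (rad \<xi> ^ m * gauss (2 * j) s \<xi>)
    = bessel_coeff (\<beta> j) m * (real n * \<bar>\<xi> * x\<bar> powr (1 / real n) / 2) ^ (2 * m)
      * ((x * \<xi>) ^ j * gauss j s \<xi>)"
proof -
  have "gauss (2 * j) s \<xi> = \<xi> ^ j * gauss j s \<xi>"
    by (simp add: gauss_def mult_2 power_add)
  then show ?thesis
    unfolding bessel_argument_power hankel_coeff_def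
    by (simp only: power_mult_distrib mult_ac)
qed

lemma hankel_kernel_gauss_sums:
  "(\<lambda>m. hankel_coeff j x m * (rad \<xi> ^ m * gauss (2 * j) s \<xi>))
      sums (hankel_kernel j x \<xi> * gauss j s \<xi>)"
  using sums_mult2[OF bessel_j_sums[OF beta_ge], of j "real n * \<bar>\<xi> * x\<bar> powr (1 / real n)"
    "(x * \<xi>) ^ j * gauss j s \<xi>"]
  unfolding hankel_kernel_gauss_term by (simp add: hankel_kernel_def mult_ac)

lemma hankel_kernel_gauss_abs_summable:
  "summable (\<lambda>m. \<bar>hankel_coeff j x m * (rad \<xi> ^ m * gauss (2 * j) s \<xi>)\<bar>)"
  unfolding hankel_kernel_gauss_term abs_mult[of _ "_ * gauss j s \<xi>"]
  by (intro summable_mult2 bessel_abs_summable beta_ge)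

lemma hankel_kernel_bound:
  assumes s: "s > 0"
  shows "\<bar>hankel_kernel j x \<xi>\<bar> \<le> \<bar>gauss j (- 2 * dual s) x\<bar> * \<bar>gauss j (- s / 2) \<xi>\<bar>"
proof -
  define z where "z = real n * \<bar>\<xi> * x\<bar> powr (1 / real n)"
  have "2 * (real n * sqrt (rad x) / sqrt s) * (sqrt s * sqrt (rad \<xi>))
      \<le> (real n * sqrt (rad x) / sqrt s)\<^sup>2 + (sqrt s * sqrt (rad \<xi>))\<^sup>2"
    by (rule sum_squares_bound)
  then have "z \<le> 2 * dual s * rad x + s / 2 * rad \<xi>"
    using s by (simp add: z_def bessel_argument dual_def power_mult_distrib power_divide field_simps)
  moreover have "\<bar>bessel_j (\<beta> j) z\<bar> \<le> exp z"
    using bessel_j_bound[OF beta_ge, of j z] by (simp add: z_def)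
  ultimately have "\<bar>bessel_j (\<beta> j) z\<bar> \<le> exp (2 * dual s * rad x) * exp (s / 2 * rad \<xi>)"
    unfolding exp_add[symmetric] by (meson exp_le_cancel_iff order.trans)
  then have "\<bar>(x * \<xi>) ^ j\<bar> * \<bar>bessel_j (\<beta> j) z\<bar>
      \<le> \<bar>(x * \<xi>) ^ j\<bar> * (exp (2 * dual s * rad x) * exp (s / 2 * rad \<xi>))"
    by (rule mult_left_mono) auto
  then show ?thesis
    by (simp add: hankel_kernel_def gauss_def z_def abs_mult power_mult_distrib mult_ac)
qed

lemma bessel_coeff_moment:
  assumes s: "s > 0"
  shows "bessel_coeff (\<beta> j) m * moment (\<beta> j + 1 + real m) s
      = moment (\<beta> j + 1) s * ((- 1 / s) ^ m / fact m)"
proof -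
  have "s powr - (\<beta> j + 1 + real m) = s powr - (\<beta> j + 1) * (1 / s) ^ m"
    using s by (simp add: powr_diff powr_minus powr_realpow power_inverse divide_inverse)
  moreover have "(- 1 / s) ^ m = (- 1) ^ m * (1 / s) ^ m"
    by (simp flip: power_mult_distrib)
  ultimately show ?thesis
    using Gamma_bessel_pos[OF beta_ge, of j m]
    by (simp add: bessel_coeff_def moment_def add_ac) (simp add: mult_ac)
qed

lemma hankel_coeff_moment:
  assumes "s > 0"
  shows "hankel_coeff j x m * moment (\<beta> j + 1 + real m) s
    = moment (\<beta> j + 1) s * x ^ j * ((- dual s * rad x) ^ m / fact m)"
proof -
  define y where "y = (real n)\<^sup>2 / 4 * rad x"
  have "hankel_coeff j x m * moment (\<beta> j + 1 + real m) s
      = bessel_coeff (\<beta> j) m * moment (\<beta> j + 1 + real m) s * (y ^ m * x ^ j)"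
    by (simp add: hankel_coeff_def y_def)
  also have "\<dots> = moment (\<beta> j + 1) s * x ^ j * ((- 1 / s * y) ^ m / fact m)"
    unfolding bessel_coeff_moment[OF assms] power_mult_distrib by simp
  also have "- 1 / s * y = - dual s * rad x"
    by (simp add: dual_def y_def mult.commute)
  finally show ?thesis .
qed

lemma hankel_kernel_gauss_integral:
  assumes s: "s > 0"
  shows "has_bochner_integral \<mu> (\<lambda>\<xi>. hankel_kernel j x \<xi> * gauss j s \<xi>)
      (moment (\<beta> j + 1) s * gauss j (dual s) x)"
proof (rule has_bochner_integral_sums)
  let ?f = "\<lambda>m \<xi>. hankel_coeff j x m * (rad \<xi> ^ m * gauss (2 * j) s \<xi>)"
  let ?I = "\<lambda>m. moment (\<beta> j + 1) s * x ^ j * ((- dual s * rad x) ^ m / fact m)"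
  show f: "has_bochner_integral \<mu> (?f m) (?I m)" for m
    using has_bochner_integral_mult_right[OF rad_gauss_moment[OF s], of "hankel_coeff j x m" m j]
    unfolding hankel_coeff_moment[OF s] by simp
  show "(\<lambda>m. ?f m \<xi>) sums (hankel_kernel j x \<xi> * gauss j s \<xi>)" "summable (\<lambda>m. norm (?f m \<xi>))" for \<xi>
    unfolding real_norm_def by (rule hankel_kernel_gauss_sums hankel_kernel_gauss_abs_summable)+
  have "(\<integral>\<xi>. norm (?f m \<xi>) \<partial>\<mu>) = \<bar>?I m\<bar>" for m
  proof -
    have "(\<integral>\<xi>. norm (?f m \<xi>) \<partial>\<mu>) = \<bar>\<integral>\<xi>. ?f m \<xi> \<partial>\<mu>\<bar>"
      by (simp add: abs_mult gauss_even_nonneg)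
    then show ?thesis using f[of m] by (simp add: has_bochner_integral_iff)
  qed
  moreover have "summable (\<lambda>m. \<bar>?I m\<bar>)"
    using summable_mult[OF summable_norm_exp[of "- dual s * rad x"],
      of "\<bar>moment (\<beta> j + 1) s * x ^ j\<bar>"]
    by (simp add: abs_mult divide_inverse mult_ac)
  ultimately show "summable (\<lambda>m. \<integral>\<xi>. norm (?f m \<xi>) \<partial>\<mu>)" by simp
  have "?I sums (moment (\<beta> j + 1) s * x ^ j * exp (- dual s * rad x))"
    using exp_converges[of "- dual s * rad x"]
    by (intro sums_mult) (simp add: divide_inverse mult.commute)
  then show "?I sums (moment (\<beta> j + 1) s * gauss j (dual s) x)"
    by (simp add: gauss_def mult.assoc)
qed

lemma isCont_hankel_kernel: "isCont (hankel_kernel j x) \<xi>"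
proof -
  have "isCont (\<lambda>\<xi>. real n * \<bar>\<xi> * x\<bar> powr (1 / real n)) \<xi>"
    unfolding isCont_def using n_pos
    by (intro tendsto_intros tendsto_powr') (auto simp: always_eventually)
  then have "isCont (\<lambda>\<xi>. bessel_j (\<beta> j) (real n * \<bar>\<xi> * x\<bar> powr (1 / real n))) \<xi>"
    by (rule isCont_o2[OF _ isCont_bessel_j[OF beta_ge]])
  then show ?thesis
    unfolding hankel_kernel_def[abs_def] by (intro continuous_intros)
qed

subsection \<open>Transforms of functions with bounded support\<close>

definition L2_supported :: "real \<Rightarrow> (real \<Rightarrow> complex) \<Rightarrow> bool" where
  "L2_supported R f \<longleftrightarrow> memL k n 2 f \<and> (\<forall>x. \<bar>x\<bar> > R \<longrightarrow> f x = 0)"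

definition hankel :: "nat \<Rightarrow> (real \<Rightarrow> complex) \<Rightarrow> real \<Rightarrow> complex" where
  "hankel j f \<xi> = (\<integral>x. f x * of_real (hankel_kernel j x \<xi>) \<partial>\<mu>)"

text \<open>\<open>spectral_pair j f s\<close> is the pairing of the transform of \<open>f\<close> with the Gaussian \<open>gauss j s\<close>;
  see \<open>gauss_pair_hankel\<close> and \<open>gauss_pair_FT2\<close>.\<close>

definition spectral_pair :: "nat \<Rightarrow> (real \<Rightarrow> complex) \<Rightarrow> real \<Rightarrow> complex" where
  "spectral_pair j f s = of_real (moment (\<beta> j + 1) s) * gauss_pair j f (of_real (dual s))"

context
  fixes f :: "real \<Rightarrow> complex" and R :: real
  assumes f: "L2_supported R f"
begin

lemma L2_supported_imp_L2: "memL k n 2 f"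
  using f by (simp add: L2_supported_def)

lemma L2_supported_imp_measurable [measurable]: "f \<in> borel_measurable borel"
  using L2_supported_imp_L2 by (simp add: memL_2_iff)

lemma abs_gauss_integrable_supported: "integrable \<mu> (\<lambda>x. norm (f x) * \<bar>gauss j c x\<bar>)"
proof (rule Bochner_Integration.integrable_bound)
  show "integrable \<mu> (\<lambda>x. exp (\<bar>1 - c\<bar> * rad R) * (norm (f x) * \<bar>gauss j 1 x\<bar>))"
    using abs_gauss_integrable[OF L2_supported_imp_L2] by simp
  have "norm (f x) * \<bar>gauss j c x\<bar> \<le> exp (\<bar>1 - c\<bar> * rad R) * (norm (f x) * \<bar>gauss j 1 x\<bar>)" for x
  proof (cases "\<bar>x\<bar> \<le> R")
    case True
    then have "(1 - c) * rad x \<le> \<bar>1 - c\<bar> * rad R"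
      using rad_mono[of x R] by (intro mult_mono) auto
    then have "\<bar>gauss 0 (c - 1) x\<bar> \<le> exp (\<bar>1 - c\<bar> * rad R)"
      by (simp add: gauss_def)
    moreover have "\<bar>gauss j c x\<bar> = \<bar>gauss 0 (c - 1) x\<bar> * \<bar>gauss j 1 x\<bar>"
      using gauss_mult[of 0 "c - 1" x j 1] by (simp flip: abs_mult)
    ultimately show ?thesis
      by (simp add: mult.left_commute mult_left_mono mult_right_mono)
  qed (use f in \<open>simp add: L2_supported_def\<close>)
  then show "AE x in \<mu>. norm (norm (f x) * \<bar>gauss j c x\<bar>)
      \<le> norm (exp (\<bar>1 - c\<bar> * rad R) * (norm (f x) * \<bar>gauss j 1 x\<bar>))"
    by (simp add: abs_mult)
qed simp

lemma hankel_integrand_bound: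
  "norm (f x * of_real (hankel_kernel j x \<xi>))
      \<le> norm (f x) * \<bar>gauss j (- 2 * dual 2) x\<bar> * \<bar>gauss j (- 1) \<xi>\<bar>"
  using hankel_kernel_bound[of 2 j x \<xi>] by (simp add: norm_mult mult.assoc mult_left_mono)

lemma hankel_integrable: "integrable \<mu> (\<lambda>x. f x * of_real (hankel_kernel j x \<xi>))"
proof (rule Bochner_Integration.integrable_bound)
  show "integrable \<mu> (\<lambda>x. norm (f x) * \<bar>gauss j (- 2 * dual 2) x\<bar> * \<bar>gauss j (- 1) \<xi>\<bar>)"
    by (intro integrable_mult_left abs_gauss_integrable_supported)
  show "AE x in \<mu>. norm (f x * of_real (hankel_kernel j x \<xi>))
      \<le> norm (norm (f x) * \<bar>gauss j (- 2 * dual 2) x\<bar> * \<bar>gauss j (- 1) \<xi>\<bar>)"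
    using hankel_integrand_bound by (intro AE_I2) simp
qed simp

lemma hankel_bound: "norm (hankel j f \<xi>)
    \<le> (\<integral>x. norm (f x) * \<bar>gauss j (- 2 * dual 2) x\<bar> \<partial>\<mu>) * \<bar>gauss j (- 1) \<xi>\<bar>"
proof -
  have "norm (hankel j f \<xi>) \<le> (\<integral>x. norm (f x) * \<bar>gauss j (- 2 * dual 2) x\<bar> * \<bar>gauss j (- 1) \<xi>\<bar> \<partial>\<mu>)"
    unfolding hankel_def
    by (intro Bochner_Integration.integral_norm_bound_integral hankel_integrable integrable_mult_left
        abs_gauss_integrable_supported hankel_integrand_bound)
  then show ?thesis by simp
qed

lemma isCont_hankel: "isCont (hankel j f) \<xi>"
proof -
  have "((\<lambda>\<eta>. hankel j f \<eta>) \<longlongrightarrow> hankel j f \<xi>) (at \<xi> within ball \<xi> 1)"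
    unfolding hankel_def
  proof (rule integral_dominated_convergence_within)
    show "integrable \<mu> (\<lambda>x. norm (f x) * \<bar>gauss j (- 2 * dual 2) x\<bar> * \<bar>gauss j (- 1) (\<bar>\<xi>\<bar> + 1)\<bar>)"
      by (intro integrable_mult_left abs_gauss_integrable_supported)
    show "AE x in \<mu>. ((\<lambda>\<eta>. f x * of_real (hankel_kernel j x \<eta>)) \<longlongrightarrow>
        f x * of_real (hankel_kernel j x \<xi>)) (at \<xi> within ball \<xi> 1)"
      by (intro AE_I2 tendsto_intros
        tendsto_within_subset[OF isCont_hankel_kernel[unfolded isCont_def]]) simp
    show "AE x in \<mu>. norm (f x * of_real (hankel_kernel j x \<eta>))
        \<le> norm (f x) * \<bar>gauss j (- 2 * dual 2) x\<bar> * \<bar>gauss j (- 1) (\<bar>\<xi>\<bar> + 1)\<bar>"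
      if "\<eta> \<in> ball \<xi> 1 - {\<xi>}" for \<eta>
    proof -
      have "\<bar>\<eta>\<bar> \<le> \<bar>\<bar>\<xi>\<bar> + 1\<bar>" using that by (auto simp: dist_real_def)
      then have "\<bar>gauss j (- 1) \<eta>\<bar> \<le> \<bar>gauss j (- 1) (\<bar>\<xi>\<bar> + 1)\<bar>"
        by (auto simp: gauss_def abs_mult power_abs intro!: mult_mono power_mono rad_mono)
      then show ?thesis
        by (intro AE_I2 order.trans[OF hankel_integrand_bound] mult_left_mono) auto
    qed
  qed auto
  then show ?thesis
    unfolding isCont_def by (subst (asm) at_within_open) auto
qed

lemma hankel_measurable [measurable]: "hankel j f \<in> borel_measurable borel"
  by (intro borel_measurable_continuous_onI continuous_at_imp_continuous_on ballI isCont_hankel)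

lemma hankel_gauss_integrable:
  assumes s: "s > 1"
  shows "integrable \<mu> (\<lambda>\<xi>. hankel j f \<xi> * of_real (gauss j s \<xi>))"
proof (rule Bochner_Integration.integrable_bound)
  let ?D = "\<integral>x. norm (f x) * \<bar>gauss j (- 2 * dual 2) x\<bar> \<partial>\<mu>"
  show "integrable \<mu> (\<lambda>\<xi>. ?D * gauss (2 * j) (s - 1) \<xi>)"
    using gauss_moment[of "s - 1" j] s by (simp add: has_bochner_integral_iff)
  have "norm (hankel j f \<xi> * of_real (gauss j s \<xi>)) \<le> ?D * gauss (2 * j) (s - 1) \<xi>" for \<xi>
    using mult_right_mono[OF hankel_bound[of j \<xi>], of "\<bar>gauss j s \<xi>\<bar>"] abs_gauss_mult[of j "-1" \<xi> s]
    by (simp add: norm_mult mult.assoc)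
  then show "AE \<xi> in \<mu>. norm (hankel j f \<xi> * of_real (gauss j s \<xi>))
      \<le> norm (?D * gauss (2 * j) (s - 1) \<xi>)"
    by (intro AE_I2) (auto intro: order.trans[OF _ abs_ge_self])
qed simp

lemma hankel_gauss_product_integrable:
  assumes s: "s > 0"
  shows "integrable (\<mu> \<Otimes>\<^sub>M \<mu>) (\<lambda>(x, \<xi>). f x * of_real (hankel_kernel j x \<xi> * gauss j s \<xi>))"
proof (rule mu_pair.integrable_product_dominated)
  show "integrable \<mu> (\<lambda>x. norm (f x) * \<bar>gauss j (- 2 * dual s) x\<bar>)"
    by (rule abs_gauss_integrable_supported)
  show "integrable \<mu> (gauss (2 * j) (s / 2))"
    using gauss_moment[of "s / 2" j] s by (simp add: has_bochner_integral_iff)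
  show "(\<lambda>(x, \<xi>). f x * of_real (hankel_kernel j x \<xi> * gauss j s \<xi>)) \<in> borel_measurable (\<mu> \<Otimes>\<^sub>M \<mu>)"
    unfolding case_prod_beta by measurable
  show "norm (case (x, \<xi>) of (x, \<xi>) \<Rightarrow> f x * of_real (hankel_kernel j x \<xi> * gauss j s \<xi>))
      \<le> norm (f x) * \<bar>gauss j (- 2 * dual s) x\<bar> * gauss (2 * j) (s / 2) \<xi>" for x \<xi>
  proof -
    have "\<bar>hankel_kernel j x \<xi>\<bar> * \<bar>gauss j s \<xi>\<bar>
        \<le> \<bar>gauss j (- 2 * dual s) x\<bar> * (\<bar>gauss j (- s / 2) \<xi>\<bar> * \<bar>gauss j s \<xi>\<bar>)"
      using mult_right_mono[OF hankel_kernel_bound[OF s]] by (simp only: mult.assoc abs_ge_zero)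
    then show ?thesis
      unfolding abs_gauss_mult by (simp add: norm_mult abs_mult mult.assoc mult_left_mono)
  qed
qed

lemma gauss_pair_hankel:
  assumes s: "s > 0"
  shows "gauss_pair j (hankel j f) (of_real s) = spectral_pair j f s"
proof -
  let ?g = "\<lambda>x \<xi>. f x * complex_of_real (hankel_kernel j x \<xi> * gauss j s \<xi>)"
  have "gauss_pair j (hankel j f) (of_real s) = (\<integral>\<xi>. (\<integral>x. ?g x \<xi> \<partial>\<mu>) \<partial>\<mu>)"
    unfolding gauss_pair_def cgauss_of_real hankel_def
    by (subst integral_mult_left_zero[symmetric]) (simp add: mult.assoc)
  also have "\<dots> = (\<integral>x. (\<integral>\<xi>. ?g x \<xi> \<partial>\<mu>) \<partial>\<mu>)"
    by (rule mu_pair.Fubini_integral[OF hankel_gauss_product_integrable[OF s]])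
  also have "\<dots> = (\<integral>x. f x * of_real (moment (\<beta> j + 1) s * gauss j (dual s) x) \<partial>\<mu>)"
    unfolding integral_mult_right_zero integral_complex_of_real
    using hankel_kernel_gauss_integral[OF s, of j] by (simp add: has_bochner_integral_iff)
  also have "\<dots> = (\<integral>x. of_real (moment (\<beta> j + 1) s) * (f x * cgauss j (of_real (dual s)) x) \<partial>\<mu>)"
    by (simp add: cgauss_of_real mult_ac)
  also have "\<dots> = spectral_pair j f s"
    unfolding spectral_pair_def gauss_pair_def by (rule integral_mult_right_zero)
  finally show ?thesis .
qed

lemma hankel_minus: "hankel j f (- \<xi>) = (- 1) ^ j * hankel j f \<xi>"
proof -
  have "hankel_kernel j x (- \<xi>) = (- 1) ^ j * hankel_kernel j x \<xi>" for x
    by (simp add: hankel_kernel_def power_minus[of "x * \<xi>" j])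
  then show ?thesis
    unfolding hankel_def integral_mult_right_zero[symmetric] by (simp add: mult_ac)
qed

end

subsection \<open>Square integrability of the transforms\<close>

lemma moment_dual_product:
  assumes "s > 0" "t > 0"
  shows "moment a s * moment a t * moment a (dual s + dual t)
      = moment a 1 * moment a ((real n)\<^sup>2 / 4) * moment a (s + t)"
proof -
  have "s powr - a * (t powr - a * (dual s + dual t) powr - a)
      = (s * t * (dual s + dual t)) powr - a"
    using assms by (simp add: powr_mult dual_pos add_pos_pos less_imp_le)
  also have "s * t * (dual s + dual t) = (real n)\<^sup>2 / 4 * (s + t)"
    using assms by (simp add: dual_def field_simps)
  also have "\<dots> powr - a = ((real n)\<^sup>2 / 4) powr - a * (s + t) powr - a"
    using assms by (intro powr_mult)
  finally show ?thesis
    unfolding moment_scale[of a s] moment_scale[of a t] moment_scale[of a "_ + _"]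
      moment_scale[of a "_ / 4"]
    by simp
qed

lemma gauss_sum_square_integral:
  assumes s: "\<And>i. s i > 0"
  shows "has_bochner_integral \<mu> (\<lambda>x. (\<Sum>i\<le>d::nat. a i * gauss j (s i) x)\<^sup>2)
    (\<Sum>i\<le>d. \<Sum>l\<le>d. a i * a l * moment (\<beta> j + 1) (s i + s l))"
proof -
  have "has_bochner_integral \<mu> (\<lambda>x. \<Sum>i\<le>d. \<Sum>l\<le>d. a i * a l * (gauss j (s i) x * gauss j (s l) x))
    (\<Sum>i\<le>d. \<Sum>l\<le>d. a i * a l * moment (\<beta> j + 1) (s i + s l))"
    by (intro has_bochner_integral_sum has_bochner_integral_mult_right gauss_inner add_pos_pos s)
  also have "(\<lambda>x. \<Sum>i\<le>d. \<Sum>l\<le>d. a i * a l * (gauss j (s i) x * gauss j (s l) x))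
      = (\<lambda>x. (\<Sum>i\<le>d. a i * gauss j (s i) x)\<^sup>2)"
    by (simp add: power2_eq_square sum_product mult_ac)
  finally show ?thesis .
qed

definition plancherel_const :: "nat \<Rightarrow> real" where
  "plancherel_const j = moment (\<beta> j + 1) 1 * moment (\<beta> j + 1) ((real n)\<^sup>2 / 4)"

lemma gauss_sum_plancherel:
  assumes s: "\<And>i. s i > 0"
  shows "has_bochner_integral \<mu> (\<lambda>x. (\<Sum>i\<le>d::nat. a i *
      moment (\<beta> j + 1) (s i) * gauss j (dual (s i)) x)\<^sup>2)
    (plancherel_const j * (\<integral>x. (\<Sum>i\<le>d. a i * gauss j (s i) x)\<^sup>2 \<partial>\<mu>))"
proof -
  let ?m = "moment (\<beta> j + 1)"
  have term_eq: "(a i * ?m (s i)) * (a l * ?m (s l)) * ?m (dual (s i) + dual (s l))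
      = plancherel_const j * (a i * a l * ?m (s i + s l))" for i l
    using moment_dual_product[OF s s, of "\<beta> j + 1" i l] by (simp add: plancherel_const_def)
  have "(\<integral>x. (\<Sum>i\<le>d. a i * gauss j (s i) x)\<^sup>2 \<partial>\<mu>) = (\<Sum>i\<le>d. \<Sum>l\<le>d. a i * a l * ?m (s i + s l))"
    using gauss_sum_square_integral[OF s] by (simp add: has_bochner_integral_iff)
  moreover have "has_bochner_integral \<mu> (\<lambda>x. (\<Sum>i\<le>d. a i * ?m (s i) * gauss j (dual (s i)) x)\<^sup>2)
      (\<Sum>i\<le>d. \<Sum>l\<le>d. a i * ?m (s i) * (a l * ?m (s l)) * ?m (dual (s i) + dual (s l)))"
    by (intro gauss_sum_square_integral dual_pos s)
  ultimately show ?thesis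
    unfolding term_eq by (simp add: sum_distrib_left)
qed

lemma plancherel_const_nonneg: "plancherel_const j \<ge> 0"
  using moment_pos[OF beta_plus_1_pos] n_pos by (simp add: plancherel_const_def less_imp_le)

lemma hankel_gauss_sum_bound:
  assumes f: "L2_supported R f" and s: "\<And>i. s i > 1"
  shows "(norm (\<integral>\<xi>. hankel j f \<xi> * of_real (\<Sum>i\<le>d::nat. a i * gauss j (s i) \<xi>) \<partial>\<mu>))\<^sup>2
    \<le> plancherel_const j * (L2norm k n f)\<^sup>2 * (\<integral>\<xi>. (\<Sum>i\<le>d. a i * gauss j (s i) \<xi>)\<^sup>2 \<partial>\<mu>)"
proof -
  let ?m = "moment (\<beta> j + 1)"
  have pos: "s i > 0" for i using s[of i] by linarith
  define \<psi> where "\<psi> x = (\<Sum>i\<le>d. a i * ?m (s i) * gauss j (dual (s i)) x)" for x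
  have [measurable]: "\<psi> \<in> borel_measurable borel" unfolding \<psi>_def by measurable
  have L2: "memL k n 2 f" by (rule L2_supported_imp_L2[OF f])
  have \<psi>2: "has_bochner_integral \<mu> (\<lambda>x. (\<psi> x)\<^sup>2) (plancherel_const j
      * (\<integral>\<xi>. (\<Sum>i\<le>d. a i * gauss j (s i) \<xi>)\<^sup>2 \<partial>\<mu>))"
    unfolding \<psi>_def by (rule gauss_sum_plancherel[OF pos])
  have "(\<integral>\<xi>. hankel j f \<xi> * of_real (\<Sum>i\<le>d. a i * gauss j (s i) \<xi>) \<partial>\<mu>)
      = (\<integral>\<xi>. (\<Sum>i\<le>d. of_real (a i) * (hankel j f \<xi> * of_real (gauss j (s i) \<xi>))) \<partial>\<mu>)"
    by (simp add: sum_distrib_left mult_ac)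
  also have "\<dots> = (\<Sum>i\<le>d. of_real (a i) * gauss_pair j (hankel j f) (of_real (s i)))"
    using hankel_gauss_integrable[OF f s]
    by (simp add: Bochner_Integration.integral_sum gauss_pair_def cgauss_of_real)
  also have "\<dots> = (\<Sum>i\<le>d. of_real (a i * ?m (s i)) * gauss_pair j f (of_real (dual (s i))))"
    by (simp add: gauss_pair_hankel[OF f pos] spectral_pair_def mult.assoc)
  also have "\<dots> = (\<integral>x. (\<Sum>i\<le>d. of_real (a i * ?m (s i)) *
      (f x * of_real (gauss j (dual (s i)) x))) \<partial>\<mu>)"
    using gauss_pair_integrable[OF L2, of "of_real (dual (s _))" j] dual_pos[OF pos]
    by (simp add: Bochner_Integration.integral_sum gauss_pair_def cgauss_of_real)
  also have "\<dots> = (\<integral>x. f x * of_real (\<psi> x) \<partial>\<mu>)"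
    by (simp add: \<psi>_def sum_distrib_left mult_ac)
  finally have "norm (\<integral>\<xi>. hankel j f \<xi> * of_real (\<Sum>i\<le>d. a i * gauss j (s i) \<xi>) \<partial>\<mu>)
      \<le> L2norm k n f * sqrt (\<integral>x. (\<psi> x)\<^sup>2 \<partial>\<mu>)"
    using Cauchy_Schwarz_integral[of f \<mu> "\<lambda>x. of_real (\<psi> x)"] L2 \<psi>2
    by (simp add: memL_2_iff has_bochner_integral_iff L2norm_def)
  from power_mono[OF this norm_ge_zero, of 2] show ?thesis
    using \<psi>2 by (simp add: power_mult_distrib has_bochner_integral_iff mult_ac)
qed

definition exp_rad :: "real \<Rightarrow> real" where "exp_rad x = exp (- rad x)"

definition exp_rad_inverse :: "real \<Rightarrow> real" where "exp_rad_inverse t = rad_inverse (- ln t)"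

lemma exp_rad_measurable [measurable]: "exp_rad \<in> borel_measurable borel"
  unfolding exp_rad_def by measurable

lemma exp_rad_inverse_measurable [measurable]: "exp_rad_inverse \<in> borel_measurable borel"
  unfolding exp_rad_inverse_def rad_inverse_def by measurable

lemma exp_rad_inverse_exp_rad: "exp_rad_inverse (exp_rad x) = \<bar>x\<bar>"
  by (simp add: exp_rad_inverse_def exp_rad_def rad_inverse_rad)

lemma AE_exp_rad: "AE x in \<mu>. exp_rad x \<in> {0<..<1}"
  using AE_mu_nonzero by eventually_elim (simp add: exp_rad_def rad_def)

lemma exp_rad_inverse_pos: "t \<in> {0<..<1} \<Longrightarrow> exp_rad_inverse t > 0"
  by (simp add: exp_rad_inverse_def rad_inverse_def)

lemma continuous_on_exp_rad_inverse: "continuous_on {0<..<1} exp_rad_inverse"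
  unfolding exp_rad_inverse_def rad_inverse_def
  by (intro continuous_on_powr' continuous_intros) (auto simp: less_imp_neq)

lemma continuous_on_gauss: "continuous_on {0<..} (gauss j p)"
  unfolding gauss_def rad_def by (intro continuous_intros) auto

lemma gauss_mult_exp_rad_power: "gauss j p x * exp_rad x ^ i = gauss j (p + real i) x"
  by (simp add: gauss_def exp_rad_def algebra_simps flip: exp_of_nat_mult exp_add)

context
  fixes f :: "real \<Rightarrow> complex" and R :: real and \<phi> :: "complex \<Rightarrow> real"
  assumes f: "L2_supported R f" and \<phi>: "bounded_linear \<phi>" "\<And>z. \<bar>\<phi> z\<bar> \<le> norm z"
begin

lemma component_mult_of_real: "\<phi> (z * of_real r) = \<phi> z * r"
  using bounded_linear.linear[OF \<phi>(1), THEN linear_scale, of r z]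
  by (simp add: scaleR_conv_of_real mult.commute)

lemma continuous_on_component: "continuous_on S \<phi>"
  by (rule linear_continuous_on[OF \<phi>(1)])

definition hankel_profile :: "nat \<Rightarrow> real \<Rightarrow> real" where
  "hankel_profile j t = \<phi> (hankel j f (exp_rad_inverse t)) / gauss j 2 (exp_rad_inverse t)"

lemma hankel_component_factorization:
  assumes "\<xi> \<noteq> 0"
  shows "\<phi> (hankel j f \<xi>) = gauss j 2 \<xi> * hankel_profile j (exp_rad \<xi>)"
proof -
  have "gauss j 2 \<xi> * \<phi> (hankel j f \<bar>\<xi>\<bar>) = \<phi> (hankel j f \<xi>) * gauss j 2 \<bar>\<xi>\<bar>"
    using hankel_minus[OF f, of j \<xi>] component_mult_of_real[of "hankel j f \<xi>" "(- 1) ^ j"]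
    by (cases "\<xi> \<ge> 0") (auto simp: gauss_minus mult_ac)
  then show ?thesis
    using assms by (simp add: hankel_profile_def exp_rad_inverse_exp_rad field_simps gauss_eq_0_iff)
qed

lemma continuous_on_hankel_profile: "continuous_on {0<..<1} (hankel_profile j)"
  unfolding hankel_profile_def
  by (intro continuous_on_divide continuous_on_compose2[OF continuous_on_component]
      continuous_on_compose2[OF continuous_at_imp_continuous_on[of UNIV] continuous_on_exp_rad_inverse]
      continuous_on_compose2[OF continuous_on_gauss continuous_on_exp_rad_inverse])
     (auto simp: isCont_hankel[OF f] gauss_eq_0_iff dest: exp_rad_inverse_pos)

lemma hankel_component_polynomial_bound:
  assumes "real_polynomial_function P"
  shows "(\<integral>\<xi>. \<phi> (hankel j f \<xi>) * (gauss j 2 \<xi> * P (exp_rad \<xi>)) \<partial>\<mu>)\<^sup>2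
    \<le> plancherel_const j * (L2norm k n f)\<^sup>2 * (\<integral>\<xi>. (gauss j 2 \<xi> * P (exp_rad \<xi>))\<^sup>2 \<partial>\<mu>)"
proof -
  obtain a d where P: "P = (\<lambda>t. \<Sum>i\<le>d. a i * t ^ i)"
    using assms by (auto simp: real_polynomial_function_iff_sum)
  have sum: "gauss j 2 \<xi> * P (exp_rad \<xi>) = (\<Sum>i\<le>d. a i * gauss j (2 + real i) \<xi>)" for \<xi>
    by (simp add: P sum_distrib_left mult.left_commute gauss_mult_exp_rad_power)
  have "integrable \<mu> (\<lambda>\<xi>. \<Sum>i\<le>d. of_real (a i) * (hankel j f \<xi> * of_real (gauss j (2 + real i) \<xi>)))"
    by (intro Bochner_Integration.integrable_sum integrable_mult_right
      hankel_gauss_integrable[OF f]) simp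
  then have "integrable \<mu> (\<lambda>\<xi>. hankel j f \<xi> * of_real (gauss j 2 \<xi> * P (exp_rad \<xi>)))"
    unfolding sum by (simp add: sum_distrib_left mult_ac)
  from integral_bounded_linear[OF \<phi>(1) this]
  have "(\<integral>\<xi>. \<phi> (hankel j f \<xi>) * (gauss j 2 \<xi> * P (exp_rad \<xi>)) \<partial>\<mu>)\<^sup>2
      \<le> (norm (\<integral>\<xi>. hankel j f \<xi> * of_real (gauss j 2 \<xi> * P (exp_rad \<xi>)) \<partial>\<mu>))\<^sup>2"
    using power_mono[OF \<phi>(2) abs_ge_zero, of _ 2] by (simp only: component_mult_of_real power2_abs)
  also have "\<dots> \<le> plancherel_const j * (L2norm k n f)\<^sup>2 * (\<integral>\<xi>. (gauss j 2 \<xi> * P (exp_rad \<xi>))\<^sup>2 \<partial>\<mu>)"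
    unfolding sum by (rule hankel_gauss_sum_bound[OF f]) simp
  finally show ?thesis .
qed

text \<open>Without square integrability the limit defining \<open>FT2\<close> would be void, because \<open>L2norm\<close> is \<open>0\<close>
  on functions that are not square integrable.\<close>

lemma hankel_component_square_integrable: "integrable \<mu> (\<lambda>\<xi>. (\<phi> (hankel j f \<xi>))\<^sup>2)"
proof (rule square_integrable_if_polynomial_duality_bound)
  note [measurable] = hankel_measurable[OF f] borel_measurable_continuous_onI[OF continuous_on_component]
  show "(\<lambda>\<xi>. \<phi> (hankel j f \<xi>)) \<in> borel_measurable \<mu>" by measurable
  show "hankel_profile j \<in> borel_measurable borel" unfolding hankel_profile_def by measurable
  show "AE \<xi> in \<mu>. exp_rad \<xi> \<in> {0<..<1}" by (rule AE_exp_rad)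
  show "AE \<xi> in \<mu>. \<phi> (hankel j f \<xi>) = gauss j 2 \<xi> * hankel_profile j (exp_rad \<xi>)"
    using AE_mu_nonzero by eventually_elim (rule hankel_component_factorization)
  show "continuous_on {0<..<1} (hankel_profile j)" by (rule continuous_on_hankel_profile)
  show "integrable \<mu> (\<lambda>\<xi>. (gauss j 2 \<xi>)\<^sup>2)"
    using gauss_inner[of 2 2 j] by (simp add: power2_eq_square has_bochner_integral_iff)
  show "integrable \<mu> (\<lambda>\<xi>. \<phi> (hankel j f \<xi>) * gauss j 2 \<xi>)"
    using integrable_bounded_linear[OF \<phi>(1) hankel_gauss_integrable[OF f, of 2 j]]
    by (simp add: component_mult_of_real)
  show "plancherel_const j * (L2norm k n f)\<^sup>2 \<ge> 0" by (simp add: plancherel_const_nonneg)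
qed (auto intro: hankel_component_polynomial_bound)

end

lemma hankel_L2:
  assumes f: "L2_supported R f"
  shows "memL k n 2 (hankel j f)"
proof -
  have "integrable \<mu> (\<lambda>\<xi>. (Re (hankel j f \<xi>))\<^sup>2)" "integrable \<mu> (\<lambda>\<xi>. (Im (hankel j f \<xi>))\<^sup>2)"
    by (rule hankel_component_square_integrable[OF f];
        simp add: bounded_linear_Re bounded_linear_Im abs_Re_le_cmod abs_Im_le_cmod)+
  then have "integrable \<mu> (\<lambda>\<xi>. (norm (hankel j f \<xi>))\<^sup>2)"
    by (simp add: cmod_power2)
  then show ?thesis by (simp add: memL_2_iff hankel_measurable[OF f])
qed

section \<open>The generalized Fourier transform\<close>

definition ft_coeff :: "nat \<Rightarrow> complex" where
  "ft_coeff j = (if j = 0 then 1 else (- \<i>) ^ n *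
      of_real ((real n / 2) ^ n * Gamma (\<alpha> + 1) / Gamma (\<alpha> + real n + 1)))"

lemma ft_coeff_nonzero: "ft_coeff j \<noteq> 0"
  using Gamma_alpha_pos Gamma_bessel_pos[OF beta_ge, of 1 0] n_pos by (simp add: ft_coeff_def \<beta>_def)

lemma kernel_B_eq_hankel_kernels:
  "kernel_B k n x \<xi>
    = ft_coeff 0 * of_real (hankel_kernel 0 x \<xi>) + ft_coeff 1 * of_real (hankel_kernel 1 x \<xi>)"
  by (simp add: kernel_B_def ft_coeff_def hankel_kernel_def \<beta>_def mult_ac)

context
  fixes f :: "real \<Rightarrow> complex" and R :: real
  assumes f: "L2_supported R f"
begin

lemma FT1_eq_hankel: "FT1 k n f = (\<lambda>\<xi>. ft_coeff 0 * hankel 0 f \<xi> + ft_coeff 1 * hankel 1 f \<xi>)"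
proof
  fix \<xi>
  have "FT1 k n f \<xi> = (\<integral>x. ft_coeff 0 * (f x * of_real (hankel_kernel 0 x \<xi>))
      + ft_coeff 1 * (f x * of_real (hankel_kernel 1 x \<xi>)) \<partial>\<mu>)"
    unfolding FT1_def kernel_B_eq_hankel_kernels by (simp add: algebra_simps)
  then show "FT1 k n f \<xi> = ft_coeff 0 * hankel 0 f \<xi> + ft_coeff 1 * hankel 1 f \<xi>"
    using hankel_integrable[OF f] by (simp add: hankel_def)
qed

lemma FT1_L2: "memL k n 2 (FT1 k n f)"
  unfolding FT1_eq_hankel by (intro memL_2_add memL_2_cmult hankel_L2[OF f])

lemma gauss_pair_hankel_opposite_parity:
  assumes "i + j = 1"
  shows "gauss_pair i (hankel j f) p = 0"
proof -
  have "(- 1 :: complex) ^ i * (- 1) ^ j = - 1"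
    by (simp add: assms flip: power_add)
  moreover have "hankel j f (- x) * cgauss i p (- x)
      = (- 1) ^ i * (- 1) ^ j * (hankel j f x * cgauss i p x)" for x
    by (simp add: hankel_minus[OF f] cgauss_minus)
  ultimately show ?thesis
    unfolding gauss_pair_def using hankel_measurable[OF f, of j] by (intro integral_mu_odd) auto
qed

lemma gauss_pair_FT1:
  assumes s: "s > 0" and j: "j < 2"
  shows "gauss_pair j (FT1 k n f) (of_real s) = ft_coeff j * spectral_pair j f s"
proof -
  have "gauss_pair j (FT1 k n f) (of_real s)
      = ft_coeff 0 * gauss_pair j (hankel 0 f) (of_real s)
        + ft_coeff 1 * gauss_pair j (hankel 1 f) (of_real s)"
    unfolding FT1_eq_hankel using s
    by (simp add: gauss_pair_add gauss_pair_cmult memL_2_cmult hankel_L2[OF f])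
  also have "\<dots> = ft_coeff j * gauss_pair j (hankel j f) (of_real s)"
    using j by (auto simp: less_2_cases_iff gauss_pair_hankel_opposite_parity)
  finally show ?thesis by (simp add: gauss_pair_hankel[OF f s])
qed

end

definition truncate :: "real \<Rightarrow> (real \<Rightarrow> complex) \<Rightarrow> real \<Rightarrow> complex" where
  "truncate R f x = indicator {-R..R} x * f x"

lemma L2_supported_truncate:
  assumes f: "memL k n 2 f"
  shows "L2_supported R (truncate R f)"
proof -
  have [measurable]: "f \<in> borel_measurable borel" using f by (simp add: memL_2_iff)
  have "memL k n 2 (truncate R f)"
    unfolding truncate_def by (rule memL_2_dominated[OF f]) (auto simp: indicator_def)
  then show ?thesis by (auto simp: L2_supported_def truncate_def indicator_def)
qed

lemma gauss_pair_tendsto_if_L2_tendsto: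
  assumes p: "Re p > 0" and g: "memL k n 2 g" and f: "\<And>R. memL k n 2 (f R)"
    and lim: "((\<lambda>R. L2norm k n (\<lambda>x. f R x - g x)) \<longlongrightarrow> 0) F"
  shows "((\<lambda>R. gauss_pair j (f R) p) \<longlongrightarrow> gauss_pair j g p) F"
proof -
  let ?K = "sqrt (moment (\<beta> j + 1) (2 * Re p))"
  have "((\<lambda>R. gauss_pair j (f R) p - gauss_pair j g p) \<longlongrightarrow> 0) F"
  proof (rule Lim_null_comparison)
    show "((\<lambda>R. L2norm k n (\<lambda>x. f R x - g x) * ?K) \<longlongrightarrow> 0) F"
      using tendsto_mult_left_zero[OF lim] .
    show "\<forall>\<^sub>F R in F. norm (gauss_pair j (f R) p - gauss_pair j g p)
        \<le> L2norm k n (\<lambda>x. f R x - g x) * ?K"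
      unfolding gauss_pair_diff[OF f g p, symmetric]
      by (intro always_eventually allI gauss_pair_bound memL_2_diff f g p)
  qed
  then show ?thesis by (simp add: LIM_zero_iff)
qed

lemma gauss_pair_truncate_tendsto:
  assumes f: "memL k n 2 f" and p: "Re p > 0"
  shows "((\<lambda>R. gauss_pair j (truncate R f) p) \<longlongrightarrow> gauss_pair j f p) at_top"
  unfolding gauss_pair_def
proof (rule integral_dominated_convergence_at_top)
  have [measurable]: "f \<in> borel_measurable borel" using f by (simp add: memL_2_iff)
  show "(\<lambda>x. f x * cgauss j p x) \<in> borel_measurable \<mu>"
    "(\<lambda>x. truncate R f x * cgauss j p x) \<in> borel_measurable \<mu>" for R
    unfolding truncate_def by measurable
  show "integrable \<mu> (\<lambda>x. norm (f x * cgauss j p x))"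
    by (intro integrable_norm gauss_pair_integrable f p)
  show "\<forall>\<^sub>F R in at_top. AE x in \<mu>. norm (truncate R f x * cgauss j p x)
      \<le> norm (f x * cgauss j p x)"
    by (intro always_eventually allI AE_I2) (auto simp: truncate_def norm_mult indicator_def)
  have "\<forall>\<^sub>F R in at_top. truncate R f x * cgauss j p x = f x * cgauss j p x" for x
    using eventually_ge_at_top[of "\<bar>x\<bar>"] by eventually_elim (auto simp: truncate_def indicator_def)
  then show "AE x in \<mu>. ((\<lambda>R. truncate R f x * cgauss j p x) \<longlongrightarrow> f x * cgauss j p x) at_top"
    by (intro AE_I2 tendsto_eventually)
qed

lemma gauss_pair_FT2:
  assumes f: "memL k n 2 f" and g: "FT2 k n f g" and s: "s > 0" and j: "j < 2"
  shows "gauss_pair j g (of_real s) = ft_coeff j * spectral_pair j f s"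
proof -
  note supported = L2_supported_truncate[OF f]
  have "((\<lambda>R. L2norm k n (\<lambda>\<xi>. FT1 k n (truncate R f) \<xi> - g \<xi>)) \<longlongrightarrow> 0) at_top"
    using g by (simp add: FT2_def truncate_def[abs_def])
  then have "((\<lambda>R. gauss_pair j (FT1 k n (truncate R f)) (of_real s))
      \<longlongrightarrow> gauss_pair j g (of_real s)) at_top"
    using g s by (intro gauss_pair_tendsto_if_L2_tendsto FT1_L2[OF supported]) (auto simp: FT2_def)
  moreover have "((\<lambda>R. gauss_pair j (FT1 k n (truncate R f)) (of_real s))
      \<longlongrightarrow> ft_coeff j * spectral_pair j f s) at_top"
    unfolding gauss_pair_FT1[OF supported s j] spectral_pair_def
    by (intro tendsto_intros gauss_pair_truncate_tendsto f) (simp add: dual_pos s)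
  ultimately show ?thesis
    by (rule tendsto_unique[OF trivial_limit_at_top_linorder])
qed

lemma spectral_pair_has_vector_derivative:
  assumes w: "is_wlap k n f g" and s: "s > 0" and j: "j < 2"
  shows "(spectral_pair j f has_vector_derivative spectral_pair j g s) (at s)"
proof -
  obtain Ff Fg where f: "memL k n 2 f" "FT2 k n f Ff" and g: "memL k n 2 g" "FT2 k n g Fg"
    and ae: "AE \<xi> in \<mu>. Fg \<xi> = - of_real (rad \<xi>) * Ff \<xi>"
    using w by (auto simp: is_wlap_def rad_def)
  have Ff: "memL k n 2 Ff" and Fg: "memL k n 2 Fg" using f g by (auto simp: FT2_def)
  then have [measurable]: "Ff \<in> borel_measurable borel" "Fg \<in> borel_measurable borel"
    by (auto simp: memL_2_iff)
  have "gauss_pair j Fg (of_real s) = gauss_pair j (\<lambda>\<xi>. - of_real (rad \<xi>) * Ff \<xi>) (of_real s)"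
    by (intro gauss_pair_cong_AE[OF ae]) auto
  moreover have "(gauss_pair j Ff has_field_derivative gauss_pair j (\<lambda>\<xi>. - of_real (rad \<xi>) * Ff \<xi>)
      (of_real s)) (at (of_real s))"
    using s by (intro gauss_pair_has_field_derivative[of _ 0] abs_gauss_integrable Ff) auto
  ultimately have "((\<lambda>t. gauss_pair j Ff (of_real t) / ft_coeff j)
      has_vector_derivative gauss_pair j Fg (of_real s) / ft_coeff j) (at s)"
    by (intro has_vector_derivative_divide has_vector_derivative_real_field) simp
  then show ?thesis
    unfolding gauss_pair_FT2[OF g s j] using s
    by (auto simp: gauss_pair_FT2[OF f _ j] ft_coeff_nonzero
        intro: has_vector_derivative_transform_within_open[where S = "{0<..}"])
qed

end

section \<open>Gaussian pairings determine a function\<close>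

context generalized_fourier
begin

lemma AE_symmetrization_zero_if_gauss_pair_zero:
  assumes f: "memL k n 2 f" and zero: "\<And>p. p > 0 \<Longrightarrow> gauss_pair j f (of_real p) = 0"
  shows "AE x in \<mu>. f x * of_real (gauss j 1 x) + f (- x) * of_real (gauss j 1 (- x)) = 0"
proof -
  have [measurable]: "f \<in> borel_measurable borel" using f by (simp add: memL_2_iff)
  define g where "g x = f x * of_real (gauss j 1 x) + f (- x) * of_real (gauss j 1 (- x))" for x
  define h where "h t = g (exp_rad_inverse t)" for t
  have [measurable]: "h \<in> borel_measurable borel" unfolding h_def g_def by measurable
  have h: "h (exp_rad x) = g x" for x
    by (cases "x \<ge> 0") (simp_all add: h_def g_def exp_rad_inverse_exp_rad)
  have int: "integrable \<mu> (\<lambda>x. f x * of_real (gauss j p x))" if "p > 0" for p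
    using gauss_pair_integrable[OF f, of "of_real p" j] that by (simp add: cgauss_of_real)
  have int_minus: "integrable \<mu> (\<lambda>x. f (- x) * of_real (gauss j p (- x)))" if "p > 0" for p
    using integrable_mu_reflect[OF int[OF that]] .
  have "AE t in distr \<mu> borel exp_rad. h t = 0"
  proof (rule AE_zero_if_moments_zero)
    show "AE t in distr \<mu> borel exp_rad. t \<in> {0..1}"
      using AE_exp_rad by (subst AE_distr_iff) (auto elim: eventually_mono)
    show "integrable (distr \<mu> borel exp_rad) h"
      using int[of 1] int_minus[of 1] by (subst integrable_distr_eq) (auto simp: h g_def)
    fix i :: nat
    have power: "exp_rad x ^ i *\<^sub>R g x = f x * of_real (gauss j (1 + real i) x) +
        f (- x) * of_real (gauss j (1 + real i) (- x))" for x
      using gauss_mult_exp_rad_power[of j 1 x i] gauss_mult_exp_rad_power[of j 1 "- x" i]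
      by (simp add: g_def exp_rad_def scaleR_conv_of_real algebra_simps
        flip: of_real_mult of_real_power)
    have "(\<integral>t. t ^ i *\<^sub>R h t \<partial>distr \<mu> borel exp_rad) = (\<integral>x. exp_rad x ^ i *\<^sub>R g x \<partial>\<mu>)"
      by (subst integral_distr) (auto simp: h)
    also have "\<dots> = (\<integral>x. f x * of_real (gauss j (1 + real i) x) \<partial>\<mu>)
        + (\<integral>x. f (- x) * of_real (gauss j (1 + real i) (- x)) \<partial>\<mu>)"
      unfolding power by (intro Bochner_Integration.integral_add int int_minus) auto
    also have "(\<integral>x. f (- x) * of_real (gauss j (1 + real i) (- x)) \<partial>\<mu>)
        = (\<integral>x. f x * of_real (gauss j (1 + real i) x) \<partial>\<mu>)"
      by (rule integral_mu_reflect[of "\<lambda>x. f x * of_real (gauss j (1 + real i) x)"]) measurable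
    also have "(\<integral>x. f x * of_real (gauss j (1 + real i) x) \<partial>\<mu>) = 0"
      using zero[of "1 + real i"] unfolding gauss_pair_def cgauss_of_real by simp
    finally show "(\<integral>t. t ^ i *\<^sub>R h t \<partial>distr \<mu> borel exp_rad) = 0" by simp
  qed simp
  then have "AE x in \<mu>. h (exp_rad x) = 0"
    by (subst (asm) AE_distr_iff) auto
  then show ?thesis by (simp add: h g_def)
qed

lemma AE_zero_if_gauss_pairs_zero:
  assumes f: "memL k n 2 f" and zero: "\<And>j p. j < 2 \<Longrightarrow> p > 0 \<Longrightarrow> gauss_pair j f (of_real p) = 0"
  shows "AE x in \<mu>. f x = 0"
proof -
  have sym: "AE x in \<mu>. f x * of_real (gauss j 1 x) + f (- x) * of_real (gauss j 1 (- x)) = 0"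
    if "j < 2" for j
    using AE_symmetrization_zero_if_gauss_pair_zero[OF f zero[OF that]] .
  have "AE x in \<mu>. f x * of_real (gauss 0 1 x) + f (- x) * of_real (gauss 0 1 (- x)) = 0"
    and "AE x in \<mu>. f x * of_real (gauss 1 1 x) + f (- x) * of_real (gauss 1 1 (- x)) = 0"
    by (rule sym; simp)+
  with AE_mu_nonzero show ?thesis
  proof eventually_elim
    case (elim x)
    then have "exp (- rad x) * (f x + f (- x)) = 0" "x * exp (- rad x) * (f x - f (- x)) = 0"
      by (simp_all add: gauss_def algebra_simps)
    then have "f x + f (- x) = 0" "f x - f (- x) = 0" using elim by auto
    then show ?case by simp
  qed
qed

end

section \<open>Gluing two half-planes\<close>

lemma polynomial_growth_decay_zero:
  fixes K :: "complex \<Rightarrow> complex"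
  assumes hol: "K holomorphic_on UNIV"
    and growth: "\<And>z. norm z \<ge> 1 \<Longrightarrow> norm (K z) \<le> B * norm z ^ N"
    and decay: "((\<lambda>x. K (of_real x)) \<longlongrightarrow> 0) at_top"
  shows "K z = 0"
proof -
  define c where "c i = (deriv ^^ i) K 0 / fact i" for i
  have K: "K z = (\<Sum>i\<le>N. c i * z ^ i)" for z
    unfolding c_def by (rule Liouville_polynomial[OF hol growth])
  have inf: "filterlim (\<lambda>x::real. complex_of_real x) at_infinity at_top"
    by (simp add: filterlim_at_infinity_conv_norm_at_top filterlim_abs_real)
  have higher: "c i = 0" if "1 \<le> i" "i \<le> N" for i
  proof (rule ccontr)
    assume "c i \<noteq> 0"
    then have "eventually (\<lambda>z. 1 \<le> norm (\<Sum>i\<le>N. c i * z ^ i)) at_infinity"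
      using that by (intro polyfun_extremal exI[of _ i]) auto
    then have "eventually (\<lambda>x. 1 \<le> norm (K (of_real x))) at_top"
      unfolding K[symmetric] by (rule eventually_compose_filterlim[OF _ inf])
    moreover have "eventually (\<lambda>x. norm (K (of_real x)) < 1) at_top"
      using order_tendstoD(2)[OF tendsto_norm_zero[OF decay], of 1] by simp
    ultimately have "eventually (\<lambda>x::real. False) at_top"
      by eventually_elim simp
    then show False by simp
  qed
  have const: "K z = c 0" for z
    unfolding K using higher by (subst sum.remove[of _ 0]) auto
  then have "c 0 = 0"
    using decay by (simp add: tendsto_const_iff)
  then show ?thesis by (simp add: const)
qed

definition transplant :: "real \<Rightarrow> (complex \<Rightarrow> complex) \<Rightarrow> complex \<Rightarrow> complex" where
  "transplant b W q = (1 / (1 - q)) powr of_real b * W (q / (1 - q))"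

lemma transplant_of_real:
  assumes "x < 1"
  shows "transplant b W (of_real x) = of_real ((1 / (1 - x)) powr b) * W (of_real (x / (1 - x)))"
proof -
  have "1 / (1 - complex_of_real x) = of_real (1 / (1 - x))" by simp
  then have "(1 / (1 - complex_of_real x)) powr of_real b = of_real ((1 / (1 - x)) powr b)"
    using assms by (simp only: powr_of_real divide_nonneg_nonneg)
  then show ?thesis by (simp add: transplant_def)
qed

lemma Re_transplant_argument:
  assumes "Re q < 1"
  shows "Re (q / (1 - q)) + 1 = (1 - Re q) / (norm (1 - q))\<^sup>2" and "norm (1 - q) > 0"
proof -
  have nz: "1 - q \<noteq> 0" using assms by (auto simp: complex_eq_iff)
  then show "norm (1 - q) > 0" by simp
  have "q / (1 - q) + 1 = 1 / (1 - q)" using nz by (simp add: field_simps)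
  then have "Re (q / (1 - q)) + 1 = Re (1 / (1 - q))" by (metis plus_complex.sel(1) one_complex.sel(1))
  then show "Re (q / (1 - q)) + 1 = (1 - Re q) / (norm (1 - q))\<^sup>2"
    by (simp add: Re_divide cmod_power2)
qed

lemma transplant_holomorphic:
  assumes W: "W holomorphic_on {p. Re p > -1}"
  shows "transplant b W holomorphic_on {q. Re q < 1}"
proof -
  have nz: "1 - q \<noteq> 0" if "Re q < 1" for q using that by (auto simp: complex_eq_iff)
  have Re: "Re (q / (1 - q)) > - 1" if "Re q < 1" for q
    using Re_transplant_argument[OF that] that by (smt (verit) divide_pos_pos zero_less_power)
  have "1 / (1 - q) \<notin> \<real>\<^sub>\<le>\<^sub>0" if "Re q < 1" for q
  proof -
    have "1 / (1 - q) = q / (1 - q) + 1" using nz[OF that] by (simp add: field_simps)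
    then show ?thesis using Re[OF that] by (auto simp: complex_nonpos_Reals_iff)
  qed
  then have "(\<lambda>q. (1 / (1 - q)) powr of_real b) holomorphic_on {q. Re q < 1}"
    using nz by (intro holomorphic_intros) auto
  moreover have "(W \<circ> (\<lambda>q. q / (1 - q))) holomorphic_on {q. Re q < 1}"
    using nz Re by (intro holomorphic_on_compose_gen[OF _ W] holomorphic_intros) auto
  ultimately show ?thesis
    unfolding transplant_def[abs_def] comp_def by (intro holomorphic_on_mult)
qed

lemma transplant_growth:
  assumes W: "\<And>p. Re p > -1 \<Longrightarrow> norm (W p) \<le> B * (Re p + 1) powr - g" and g: "g \<ge> 0"
    and q: "Re q \<le> 1 / 2"
  shows "norm (transplant b W q) \<le> \<bar>B\<bar> * 2 powr g * norm (1 - q) powr (2 * g - b)"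
proof -
  define w where "w = norm (1 - q)"
  have w: "w > 0" and Re: "Re (q / (1 - q)) + 1 = (1 - Re q) / w\<^sup>2"
    using Re_transplant_argument[of q] q by (auto simp: w_def)
  have lower: "1 / (2 * w\<^sup>2) \<le> Re (q / (1 - q)) + 1"
    unfolding Re using w q by (simp add: field_simps)
  have "norm (W (q / (1 - q))) \<le> B * (Re (q / (1 - q)) + 1) powr - g"
    using lower w by (intro W) (smt (verit) zero_less_divide_1_iff zero_less_power)
  also have "\<dots> \<le> \<bar>B\<bar> * (1 / (2 * w\<^sup>2)) powr - g"
    using lower g w by (intro mult_mono powr_mono2') auto
  also have "(1 / (2 * w\<^sup>2)) powr - g = 2 powr g * w powr (2 * g)"
  proof -
    have "(1 / (2 * w\<^sup>2)) powr - g = (2 * w\<^sup>2) powr g"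
      using w by (simp add: powr_minus powr_divide field_simps)
    also have "\<dots> = 2 powr g * (w powr 2) powr g"
      using w by (simp add: powr_mult)
    finally show ?thesis by (simp add: powr_powr)
  qed
  finally have "norm (transplant b W q) \<le> (1 / w) powr b * (\<bar>B\<bar> * (2 powr g * w powr (2 * g)))"
    by (simp add: transplant_def norm_mult norm_powr_real_powr' norm_divide w_def mult_left_mono)
  also have "\<dots> = \<bar>B\<bar> * 2 powr g * w powr (2 * g - b)"
    using w by (simp add: powr_divide powr_diff)
  finally show ?thesis by (simp add: w_def)
qed

lemma holomorphic_eq_on_strip:
  fixes f g :: "complex \<Rightarrow> complex"
  assumes f: "f holomorphic_on {q. Re q > a}" and g: "g holomorphic_on {q. Re q < b}"
    and eq: "\<And>x. a < x \<Longrightarrow> x < b \<Longrightarrow> f (of_real x) = g (of_real x)" and q: "a < Re q" "Re q < b"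
  shows "f q = g q"
proof -
  let ?S = "{q. Re q > a} \<inter> {q. Re q < b}" and ?c = "(a + b) / 2"
  have c: "a < ?c" "?c < b" using q by auto
  have "f q - g q = 0"
  proof (rule analytic_continuation[where f = "\<lambda>q. f q - g q" and S = ?S
      and U = "of_real ` {a<..<b}" and \<xi> = "of_real ?c"])
    show "(\<lambda>q. f q - g q) holomorphic_on ?S"
      by (intro holomorphic_on_diff holomorphic_on_subset[OF f] holomorphic_on_subset[OF g]) auto
    show "open ?S" by (intro open_Int open_halfspace_Re_gt open_halfspace_Re_lt)
    show "connected ?S"
      by (intro convex_connected convex_Int convex_halfspace_Re_gt convex_halfspace_Re_lt)
    have "?c islimpt {a<..<b}" using c by (intro interior_limit_point) (auto simp: interior_open)
    then show "complex_of_real ?c islimpt of_real ` {a<..<b}"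
      by (rule islimpt_isCont_image) (simp, simp only: of_real_eq_iff eventually_neq_at_within)
  qed (use q c eq in auto)
  then show ?thesis by simp
qed

lemma norm_one_minus_powr_le:
  fixes q :: complex
  assumes q: "norm q \<ge> 1" and e: "e \<ge> 0"
  shows "norm (1 - q) powr e \<le> 2 powr e * norm q ^ nat \<lceil>e\<rceil>"
proof -
  have "norm (1 - q) \<le> 2 * norm q" using norm_triangle_ineq4[of 1 q] q by simp
  then have "norm (1 - q) powr e \<le> (2 * norm q) powr e" using e by (intro powr_mono2) auto
  also have "\<dots> = 2 powr e * norm q powr e" by (simp add: powr_mult)
  also have "norm q powr e \<le> norm q powr real (nat \<lceil>e\<rceil>)" using q e by (intro powr_mono) auto
  also have "\<dots> = norm q ^ nat \<lceil>e\<rceil>" using q by (intro powr_realpow) linarith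
  finally show ?thesis by simp
qed

lemma polynomial_growth_if_half_plane_bounds:
  fixes K :: "complex \<Rightarrow> complex"
  assumes right: "Re q \<ge> 1 / 2 \<Longrightarrow> norm (K q) \<le> A * Re q powr - a" and a: "a \<ge> 0"
    and left: "Re q < 1 / 2 \<Longrightarrow> norm (K q) \<le> B * norm (1 - q) powr e" and e: "e \<ge> 0"
    and q: "norm q \<ge> 1"
  shows "norm (K q) \<le> max (\<bar>A\<bar> * (1 / 2) powr - a) (\<bar>B\<bar> * 2 powr e) * norm q ^ nat \<lceil>e\<rceil>"
    (is "_ \<le> ?C * _")
proof (cases "Re q \<ge> 1 / 2")
  case True
  have "norm (K q) \<le> A * Re q powr - a" by (rule right[OF True])
  also have "\<dots> \<le> \<bar>A\<bar> * (1 / 2) powr - a"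
    using True a by (intro mult_mono powr_mono2') auto
  also have "\<dots> * 1 \<le> ?C * norm q ^ nat \<lceil>e\<rceil>"
    using one_le_power[OF q] by (intro mult_mono) (auto simp: le_max_iff_disj)
  finally show ?thesis by simp
next
  case False
  then have "norm (K q) \<le> B * norm (1 - q) powr e" by (intro left) simp
  also have "\<dots> \<le> \<bar>B\<bar> * (2 powr e * norm q ^ nat \<lceil>e\<rceil>)"
    by (intro mult_mono norm_one_minus_powr_le q e) auto
  also have "\<dots> \<le> ?C * norm q ^ nat \<lceil>e\<rceil>"
    by (simp add: mult_right_mono flip: mult.assoc)
  finally show ?thesis .
qed

lemma zero_if_transplant:
  fixes V W :: "complex \<Rightarrow> complex" and a b g A B :: real
  assumes V: "V holomorphic_on {q. Re q > 0}" and W: "W holomorphic_on {p. Re p > -1}"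
    and V_bound: "\<And>q. Re q > 0 \<Longrightarrow> norm (V q) \<le> A * Re q powr - a" and a: "a > 0"
    and W_bound: "\<And>p. Re p > -1 \<Longrightarrow> norm (W p) \<le> B * (Re p + 1) powr - g" and g: "g \<ge> 0" "2 * g \<ge> b"
    and eq: "\<And>x. 0 < x \<Longrightarrow> x < 1 \<Longrightarrow> V (of_real x) = transplant b W (of_real x)"
    and z: "Re z > 0"
  shows "V z = 0"
proof -
  define K where "K q = (if q \<in> {q. Re q > 0} then V q else transplant b W q)" for q
  have strip: "V q = transplant b W q" if "0 < Re q" "Re q < 1" for q
    by (rule holomorphic_eq_on_strip[OF V transplant_holomorphic[OF W] eq that])
  have "{q. Re q > 0} \<union> {q. Re q < 1} = UNIV" by auto
  then have "K holomorphic_on UNIV"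
    using holomorphic_on_If_Un[OF V transplant_holomorphic[OF W]
      open_halfspace_Re_gt open_halfspace_Re_lt, of b] strip
    by (simp add: K_def[abs_def])
  moreover have "norm (K q) \<le> max (\<bar>A\<bar> * (1 / 2) powr - a) (\<bar>\<bar>B\<bar> * 2 powr g\<bar> * 2 powr (2 * g - b))
      * norm q ^ nat \<lceil>2 * g - b\<rceil>"
    if "norm q \<ge> 1" for q
  proof (rule polynomial_growth_if_half_plane_bounds[OF _ _ _ _ that])
    show "norm (K q) \<le> A * Re q powr - a" if "Re q \<ge> 1 / 2"
      using V_bound[of q] that by (simp add: K_def)
    show "norm (K q) \<le> \<bar>B\<bar> * 2 powr g * norm (1 - q) powr (2 * g - b)" if "Re q < 1 / 2"
      using transplant_growth[OF W_bound g(1), of q b] strip[of q] that by (simp add: K_def)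
  qed (use a g in auto)
  moreover have "((\<lambda>x. K (of_real x)) \<longlongrightarrow> 0) at_top"
  proof (rule Lim_null_comparison)
    show "\<forall>\<^sub>F x in at_top. norm (K (of_real x)) \<le> A * x powr - a"
      using eventually_gt_at_top[of 0]
        by eventually_elim (use V_bound[of "of_real _"] in \<open>simp add: K_def\<close>)
    have "((\<lambda>x. x powr - a) \<longlongrightarrow> 0) at_top"
      using a by (intro tendsto_neg_powr filterlim_ident) auto
    then show "((\<lambda>x. A * x powr - a) \<longlongrightarrow> 0) at_top"
      by (rule tendsto_mult_right_zero)
  qed
  ultimately have "K z = 0" by (rule polynomial_growth_decay_zero)
  then show ?thesis using z by (simp add: K_def)
qed

section \<open>The heat flow\<close>

lemma is_wlap_wlap: "in_W2 k n f \<Longrightarrow> is_wlap k n f (wlap k n f)"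
  unfolding in_W2_def wlap_def by (erule someI_ex)

lemma in_W2_L2: "in_W2 k n f \<Longrightarrow> memL k n 2 f"
  by (auto simp: in_W2_def is_wlap_def)

lemma L2norm_le_W2norm: "L2norm k n f \<le> W2norm k n f"
  by (simp add: W2norm_def L2norm_nonneg)

context generalized_fourier
begin

lemma spectral_pair_add:
  assumes "memL k n 2 f" "memL k n 2 g" "s > 0"
  shows "spectral_pair j (\<lambda>x. f x + g x) s = spectral_pair j f s + spectral_pair j g s"
  using assms by (simp add: spectral_pair_def gauss_pair_add dual_pos distrib_left)

lemma spectral_pair_cmult: "spectral_pair j (\<lambda>x. c * f x) s = c * spectral_pair j f s"
  by (simp add: spectral_pair_def gauss_pair_cmult)

lemma spectral_pair_tendsto_0:
  assumes f: "\<forall>\<^sub>F y in F. memL k n 2 (f y)" and f_lim: "((\<lambda>y. L2norm k n (f y)) \<longlongrightarrow> 0) F"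
    and \<sigma>: "(\<sigma> \<longlongrightarrow> s) F" and s: "s > 0"
  shows "((\<lambda>y. spectral_pair j (f y) (\<sigma> y)) \<longlongrightarrow> 0) F"
proof (rule Lim_null_comparison)
  let ?K = "\<lambda>s. moment (\<beta> j + 1) s * sqrt (moment (\<beta> j + 1) (2 * dual s))"
  have "((\<lambda>y. ?K (\<sigma> y)) \<longlongrightarrow> ?K s) F"
    unfolding moment_def dual_def using s n_pos by (intro tendsto_intros \<sigma>) auto
  from tendsto_mult[OF f_lim this] show "((\<lambda>y. L2norm k n (f y) * ?K (\<sigma> y)) \<longlongrightarrow> 0) F" by simp
  show "\<forall>\<^sub>F y in F. norm (spectral_pair j (f y) (\<sigma> y)) \<le> L2norm k n (f y) * ?K (\<sigma> y)"
    using f order_tendstoD(1)[OF \<sigma> s]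
  proof eventually_elim
    case (elim y)
    have "moment (\<beta> j + 1) (\<sigma> y) \<ge> 0"
      using moment_pos[OF beta_plus_1_pos elim(2)] by (rule less_imp_le)
    with mult_left_mono[OF gauss_pair_bound[OF elim(1), of "of_real (dual (\<sigma> y))" j] this]
    show ?case using dual_pos[OF elim(2)] by (simp add: spectral_pair_def norm_mult mult_ac)
  qed
qed

lemma spectral_pair_difference_quotient:
  fixes h :: real
  assumes L2: "memL k n 2 f" "memL k n 2 f\<^sub>0" "memL k n 2 d" and s: "s > 0" and h: "h \<noteq> 0"
  shows "(spectral_pair j f s - z) /\<^sub>R h = spectral_pair j (\<lambda>x. (f x - f\<^sub>0 x) / of_real h - d x) s
    + spectral_pair j d s + (spectral_pair j f\<^sub>0 s - z) /\<^sub>R h"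
proof -
  define r where "r x = (f x - f\<^sub>0 x) / of_real h - d x" for x
  have r: "memL k n 2 r"
    using memL_2_diff[OF memL_2_cmult[OF memL_2_diff[OF L2(1,2)], of "inverse (of_real h)"] L2(3)]
    by (simp add: r_def[abs_def] divide_inverse mult.commute)
  have "f = (\<lambda>x. of_real h * (r x + d x) + f\<^sub>0 x)"
    using h by (auto simp: r_def)
  then have "spectral_pair j f s = spectral_pair j (\<lambda>x. of_real h * (r x + d x) + f\<^sub>0 x) s"
    by (rule arg_cong)
  also have "\<dots> = h *\<^sub>R (spectral_pair j r s + spectral_pair j d s) + spectral_pair j f\<^sub>0 s"
    using L2 r s
    by (simp add: spectral_pair_add spectral_pair_cmult memL_2_add memL_2_cmult scaleR_conv_of_real)
  finally show ?thesis
    using h by (simp add: scaleR_add_right r_def[abs_def] flip: add_diff_eq)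
qed

lemma spectral_pair_curve_has_vector_derivative:
  fixes u :: "real \<Rightarrow> real \<Rightarrow> complex"
  assumes \<tau>: "\<tau> \<in> S" and u: "\<And>y. y \<in> S \<Longrightarrow> memL k n 2 (u y)"
    and w: "is_wlap k n (u \<tau>) w" and d: "in_W2 k n d"
    and u_deriv: "((\<lambda>y. L2norm k n (\<lambda>x. (u y x - u \<tau> x) / of_real (y - \<tau>) - d x)) \<longlongrightarrow> 0)
        (at \<tau> within S)"
    and \<sigma>: "(\<sigma> has_vector_derivative m) (at \<tau> within S)" "\<sigma> \<tau> > 0" and j: "j < 2"
  shows "((\<lambda>y. spectral_pair j (u y) (\<sigma> y)) has_vector_derivative
    spectral_pair j d (\<sigma> \<tau>) + m *\<^sub>R spectral_pair j w (\<sigma> \<tau>)) (at \<tau> within S)"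
proof -
  let ?F = "at \<tau> within S" and ?r = "\<lambda>y x. (u y x - u \<tau> x) / of_real (y - \<tau>) - d x"
  have d2: "memL k n 2 d" by (rule in_W2_L2[OF d])
  have \<sigma>_lim: "(\<sigma> \<longlongrightarrow> \<sigma> \<tau>) ?F"
    using has_vector_derivative_continuous[OF \<sigma>(1)] by (simp add: continuous_within)
  have in_S: "\<forall>\<^sub>F y in ?F. y \<in> S \<and> y \<noteq> \<tau>" by (auto simp: eventually_at_filter)
  have "\<forall>\<^sub>F y in ?F. memL k n 2 (?r y)"
    using in_S by eventually_elim (auto simp: divide_inverse_commute
      intro!: memL_2_diff memL_2_cmult u \<tau> d2)
  then have remainder: "((\<lambda>y. spectral_pair j (?r y) (\<sigma> y)) \<longlongrightarrow> 0) ?F"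
    by (rule spectral_pair_tendsto_0[OF _ u_deriv \<sigma>_lim \<sigma>(2)])
  have velocity: "((\<lambda>y. spectral_pair j d (\<sigma> y)) \<longlongrightarrow> spectral_pair j d (\<sigma> \<tau>)) ?F"
    by (rule isCont_tendsto_compose[OF has_vector_derivative_continuous \<sigma>_lim])
      (rule spectral_pair_has_vector_derivative[OF is_wlap_wlap[OF d] \<sigma>(2) j])
  have "((\<lambda>y. spectral_pair j (u \<tau>) (\<sigma> y)) has_vector_derivative m *\<^sub>R spectral_pair j w (\<sigma> \<tau>)) ?F"
    using vector_diff_chain_within[OF \<sigma>(1) has_vector_derivative_at_within]
      spectral_pair_has_vector_derivative[OF w \<sigma>(2) j] by (simp add: comp_def)
  then have scale: "((\<lambda>y. (spectral_pair j (u \<tau>) (\<sigma> y) - spectral_pair j (u \<tau>) (\<sigma> \<tau>)) /\<^sub>R (y - \<tau>))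
      \<longlongrightarrow> m *\<^sub>R spectral_pair j w (\<sigma> \<tau>)) ?F"
    by (simp only: has_vector_derivative_iff_difference_quotient)
  have "\<forall>\<^sub>F y in ?F. spectral_pair j (?r y) (\<sigma> y) + spectral_pair j d (\<sigma> y)
        + (spectral_pair j (u \<tau>) (\<sigma> y) - spectral_pair j (u \<tau>) (\<sigma> \<tau>)) /\<^sub>R (y - \<tau>)
      = (spectral_pair j (u y) (\<sigma> y) - spectral_pair j (u \<tau>) (\<sigma> \<tau>)) /\<^sub>R (y - \<tau>)"
    using in_S order_tendstoD(1)[OF \<sigma>_lim \<sigma>(2)]
    by eventually_elim (rule spectral_pair_difference_quotient[symmetric], auto simp: u \<tau> d2)
  from Lim_transform_eventually[OF tendsto_add[OF tendsto_add[OF remainder velocity] scale] this]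
  show ?thesis by (simp add: has_vector_derivative_iff_difference_quotient)
qed

context
  fixes T :: real and u u' :: "real \<Rightarrow> real \<Rightarrow> complex"
  assumes C1: "C1_W2 k n T u u'"
    and heat: "\<forall>t\<in>{0..T}. AE x in \<mu>. of_real (real n) * wlap k n (u t) x - u' t x = 0"
begin

lemma solution_in_W2: "t \<in> {0..T} \<Longrightarrow> in_W2 k n (u t)"
  and velocity_in_W2: "t \<in> {0..T} \<Longrightarrow> in_W2 k n (u' t)"
  using C1 by (auto simp: C1_W2_def)

lemma solution_L2_derivative:
  assumes "\<tau> \<in> {0..T}"
  shows "((\<lambda>y. L2norm k n (\<lambda>x. (u y x - u \<tau> x) / of_real (y - \<tau>) - u' \<tau> x)) \<longlongrightarrow> 0)
      (at \<tau> within {0..T})"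
proof (rule Lim_null_comparison)
  show "((\<lambda>y. W2norm k n (\<lambda>x. (u y x - u \<tau> x) / of_real (y - \<tau>) - u' \<tau> x)) \<longlongrightarrow> 0)
      (at \<tau> within {0..T})"
    using C1 assms by (simp add: C1_W2_def)
qed (simp add: L2norm_nonneg L2norm_le_W2norm)

lemma spectral_pair_velocity:
  assumes "\<tau> \<in> {0..T}"
  shows "spectral_pair j (u' \<tau>) s = real n *\<^sub>R spectral_pair j (wlap k n (u \<tau>)) s"
proof -
  have "AE x in \<mu>. u' \<tau> x = of_real (real n) * wlap k n (u \<tau>) x"
    using bspec[OF heat assms] by eventually_elim simp
  moreover have "memL k n 2 (u' \<tau>)" "memL k n 2 (wlap k n (u \<tau>))"
    using in_W2_L2[OF velocity_in_W2[OF assms]] is_wlap_wlap[OF solution_in_W2[OF assms]]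
      by (auto simp: is_wlap_def)
  ultimately have "gauss_pair j (u' \<tau>) p = gauss_pair j (\<lambda>x. of_real (real n) * wlap k n (u \<tau>) x) p"
    for p
    by (intro gauss_pair_cong_AE) (auto simp: memL_2_iff)
  then show ?thesis
    by (simp add: spectral_pair_def gauss_pair_cmult scaleR_conv_of_real)
qed

lemma spectral_pair_transport:
  assumes t: "t \<in> {0..T}" and j: "j < 2" and s: "s > 0"
  shows "spectral_pair j (u t) s = spectral_pair j (u 0) (s + real n * t)"
proof -
  define \<sigma> where "\<sigma> y = s + real n * (t - y)" for y
  have "((\<lambda>y. spectral_pair j (u y) (\<sigma> y)) has_vector_derivative 0) (at \<tau> within {0..t})"
    if "\<tau> \<in> {0..t}" for \<tau>
  proof -
    have \<tau>: "\<tau> \<in> {0..T}" using that t by auto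
    have "\<sigma> \<tau> > 0" using that s by (simp add: \<sigma>_def add_pos_nonneg)
    moreover have "(\<sigma> has_vector_derivative - real n) (at \<tau> within {0..T})"
      unfolding \<sigma>_def has_real_derivative_iff_has_vector_derivative[symmetric]
      by (auto intro!: derivative_eq_intros)
    ultimately have "((\<lambda>y. spectral_pair j (u y) (\<sigma> y)) has_vector_derivative
        spectral_pair j (u' \<tau>) (\<sigma> \<tau>) + (- real n) *\<^sub>R spectral_pair j (wlap k n (u \<tau>)) (\<sigma> \<tau>))
          (at \<tau> within {0..T})"
      by (intro spectral_pair_curve_has_vector_derivative \<tau> in_W2_L2 is_wlap_wlap solution_in_W2 velocity_in_W2
          solution_L2_derivative j)
    then have "((\<lambda>y. spectral_pair j (u y) (\<sigma> y)) has_vector_derivative 0) (at \<tau> within {0..T})"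
      by (simp add: spectral_pair_velocity[OF \<tau>])
    then show ?thesis
      by (rule has_vector_derivative_within_subset) (use t in auto)
  qed
  then obtain c where c: "\<And>y. y \<in> {0..t} \<Longrightarrow> spectral_pair j (u y) (\<sigma> y) = c"
    using has_vector_derivative_zero_constant[of "{0..t}" "\<lambda>y. spectral_pair j (u y) (\<sigma> y)"] by auto
  show ?thesis using c[of 0] c[of t] t by (simp add: \<sigma>_def)
qed

end

subsection \<open>Gaussian decay\<close>

lemma gauss_pair_bound_scaled:
  fixes j :: nat
  assumes f: "memL k n 2 f" and \<rho>: "\<rho> > 0" and q: "Re q > 0"
  defines "b \<equiv> \<beta> j + 1"
  shows "norm (gauss_pair j f (of_real \<rho> * q)) \<le>
      L2norm k n f * sqrt (moment b (2 * \<rho>)) * Re q powr - (b / 2)"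
proof -
  have "sqrt (Re q powr - b) = Re q powr - (b / 2)"
    using q by (simp add: powr_powr flip: powr_half_sqrt)
  moreover have "moment b (2 * Re (of_real \<rho> * q)) = moment b (2 * \<rho>) * Re q powr - b"
    unfolding moment_scale[of b "2 * _"] by (simp add: powr_mult)
  ultimately show ?thesis
    using gauss_pair_bound[OF f, of "of_real \<rho> * q" j] \<rho> q by (simp add: b_def real_sqrt_mult)
qed

context
  fixes f :: "real \<Rightarrow> complex" and C \<rho> :: real
  assumes [measurable]: "f \<in> borel_measurable borel"
    and decay: "\<And>x. norm (f x) \<le> C * exp (- \<rho> * rad x)"
begin

lemma decay_abs_gauss_bound: "norm (f x) * \<bar>gauss j c x\<bar> \<le> C * \<bar>gauss j (c + \<rho>) x\<bar>"
proof -
  have "norm (f x) * \<bar>gauss j c x\<bar> \<le> C * exp (- \<rho> * rad x) * \<bar>gauss j c x\<bar>"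
    by (rule mult_right_mono[OF decay]) simp
  also have "\<dots> = C * \<bar>gauss j (c + \<rho>) x\<bar>"
    using gauss_mult[of j c x 0 \<rho>] by (simp add: gauss_def abs_mult) (simp add: mult_ac)
  finally show ?thesis .
qed

lemma decay_majorant_integral:
  assumes "c > - \<rho>"
  shows "has_bochner_integral \<mu> (\<lambda>x. C * \<bar>gauss j (c + \<rho>) x\<bar>)
      (C * moment (\<alpha> + 1 + real j * real n / 2) (c + \<rho>))"
  using has_bochner_integral_mult_right[OF rad_abs_gauss_moment[of "c + \<rho>" 0 j], of C] assms by simp

lemma decay_abs_gauss_integrable:
  assumes "c > - \<rho>"
  shows "integrable \<mu> (\<lambda>x. norm (f x) * \<bar>gauss j c x\<bar>)"
proof (rule Bochner_Integration.integrable_bound)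
  show "integrable \<mu> (\<lambda>x. C * \<bar>gauss j (c + \<rho>) x\<bar>)"
    using decay_majorant_integral[OF assms] by (simp add: has_bochner_integral_iff)
  show "AE x in \<mu>. norm (norm (f x) * \<bar>gauss j c x\<bar>) \<le> norm (C * \<bar>gauss j (c + \<rho>) x\<bar>)"
    using decay_abs_gauss_bound by (intro AE_I2) (auto intro: order.trans[OF _ abs_ge_self])
qed simp

lemma decay_gauss_pair_bound:
  assumes p: "Re p > - \<rho>"
  shows "norm (gauss_pair j f p) \<le> C * moment (\<alpha> + 1 + real j * real n / 2) (Re p + \<rho>)"
proof -
  have "norm (gauss_pair j f p) \<le> (\<integral>x. norm (f x * cgauss j p x) \<partial>\<mu>)"
    unfolding gauss_pair_def by (rule integral_norm_bound)
  also have "\<dots> \<le> (\<integral>x. C * \<bar>gauss j (Re p + \<rho>) x\<bar> \<partial>\<mu>)"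
    unfolding norm_mult norm_cgauss
    by (intro integral_mono decay_abs_gauss_integrable[OF p] decay_abs_gauss_bound
        integrable.intros[OF decay_majorant_integral[OF p]])
  also have "\<dots> = C * moment (\<alpha> + 1 + real j * real n / 2) (Re p + \<rho>)"
    by (rule has_bochner_integral_integral_eq[OF decay_majorant_integral[OF p]])
  finally show ?thesis .
qed

lemma decay_gauss_pair_bound_scaled:
  fixes j :: nat
  assumes \<rho>: "\<rho> > 0" and q: "Re q > -1"
  defines "e \<equiv> \<alpha> + 1 + real j * real n / 2"
  shows "norm (gauss_pair j f (of_real \<rho> * q)) \<le> C * moment e \<rho> * (Re q + 1) powr - e"
proof -
  have scaled: "Re (of_real \<rho> * q) + \<rho> = \<rho> * (Re q + 1)" by (simp add: algebra_simps)
  then have "Re (of_real \<rho> * q) > - \<rho>"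
    using mult_pos_pos[OF \<rho>, of "Re q + 1"] q by linarith
  from decay_gauss_pair_bound[OF this, of j] show ?thesis
    unfolding scaled e_def[symmetric] moment_scale[of e "\<rho> * _"] moment_scale[of e \<rho>] powr_mult
    by (simp add: mult.assoc)
qed

end

lemma gauss_pair_scaled_holomorphic:
  assumes "f \<in> borel_measurable borel" and "\<rho> > 0"
    and "\<And>c. c > \<rho> * c0 \<Longrightarrow> integrable \<mu> (\<lambda>x. norm (f x) * \<bar>gauss j c x\<bar>)"
  shows "(\<lambda>q. gauss_pair j f (of_real \<rho> * q)) holomorphic_on {q. Re q > c0}"
proof -
  have "(gauss_pair j f \<circ> (\<lambda>q. of_real \<rho> * q)) holomorphic_on {q. Re q > c0}"
    by (rule holomorphic_on_compose_gen[OF _ gauss_pair_holomorphic[OF assms(1,3)]])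
      (use assms(2) in \<open>auto intro!: holomorphic_intros\<close>)
  then show ?thesis by (simp add: comp_def)
qed

lemma gauss_pair_eq_transplant:
  assumes T: "T > 0" and shift:
      "\<And>s. s > 0 \<Longrightarrow> spectral_pair j g s = spectral_pair j f (s + real n * T)"
    and x: "0 < x" "x < 1"
  defines "\<rho> \<equiv> real n / (4 * T)"
  shows "gauss_pair j f (of_real \<rho> * of_real x)
      = transplant (\<beta> j + 1) (\<lambda>q. gauss_pair j g (of_real \<rho> * q)) (of_real x)"
proof -
  define b where "b = \<beta> j + 1"
  define s where "s = real n * T * (1 - x) / x"
  have s: "s > 0" "s + real n * T = real n * T / x" "dual s = \<rho> * (x / (1 - x))"
    "dual (real n * T / x) = \<rho> * x"
    using x T n_pos by (simp_all add: s_def dual_def \<rho>_def field_simps power2_eq_square)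
  have "of_real (moment b (real n * T / x)) * gauss_pair j f (of_real (\<rho> * x))
      = of_real (moment b s) * gauss_pair j g (of_real (\<rho> * (x / (1 - x))))"
    using shift[OF s(1)] unfolding s(2) by (simp add: spectral_pair_def s b_def)
  moreover have "moment b s = moment b (real n * T / x) * (1 / (1 - x)) powr b"
  proof -
    have "s = real n * T / x * (1 - x)" by (simp add: s_def)
    then have "s powr - b = (real n * T / x) powr - b * (1 - x) powr - b"
      by (simp only: powr_mult)
    then show ?thesis
      using x unfolding moment_scale[of b s] moment_scale[of b "real n * T / x"]
      by (simp add: powr_minus powr_divide field_simps)
  qed
  moreover have "moment b (real n * T / x) > 0"
    using x T n_pos by (intro moment_pos) (auto simp: b_def beta_plus_1_pos)
  ultimately have "gauss_pair j f (of_real (\<rho> * x)) =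
      of_real ((1 / (1 - x)) powr b) * gauss_pair j g (of_real (\<rho> * (x / (1 - x))))"
    by simp
  then show ?thesis
    unfolding transplant_of_real[OF x(2)] by (simp add: b_def)
qed

lemma gauss_pair_zero_if_decaying_shift:
  assumes f: "memL k n 2 f" and g: "g \<in> borel_measurable borel" and T: "T > 0" and p: "p > 0"
    and shift: "\<And>s. s > 0 \<Longrightarrow> spectral_pair j g s = spectral_pair j f (s + real n * T)"
    and decay: "\<And>x. norm (g x) \<le> C * exp (- (real n / (4 * T)) * rad x)"
  shows "gauss_pair j f (of_real p) = 0"
proof -
  define \<rho> where "\<rho> = real n / (4 * T)"
  define b where "b = \<beta> j + 1"
  define e where "e = \<alpha> + 1 + real j * real n / 2"
  have \<rho>: "\<rho> > 0" using T n_pos by (simp add: \<rho>_def)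
  have e: "e \<ge> 0" "2 * e \<ge> b" using alpha_ge by (auto simp: e_def b_def \<beta>_def add_nonneg_nonneg)
  note decay = decay[folded \<rho>_def]
  let ?V = "\<lambda>q. gauss_pair j f (of_real \<rho> * q)" and ?W = "\<lambda>q. gauss_pair j g (of_real \<rho> * q)"
  have "?V (of_real (p / \<rho>)) = 0"
  proof (rule zero_if_transplant[where V = ?V and W = ?W and b = b and g = e])
    show "?V holomorphic_on {q. Re q > 0}"
      using f by (intro gauss_pair_scaled_holomorphic abs_gauss_integrable[OF f] \<rho>)
        (auto simp: memL_2_iff)
    show "?W holomorphic_on {q. Re q > -1}"
      by (intro gauss_pair_scaled_holomorphic decay_abs_gauss_integrable[OF g decay] g \<rho>) simp
    show "norm (?V q) \<le> L2norm k n f * sqrt (moment b (2 * \<rho>)) * Re q powr - (b / 2)" if "Re q > 0"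
      for q
      using gauss_pair_bound_scaled[OF f \<rho> that] by (simp add: b_def)
    show "norm (?W q) \<le> C * moment e \<rho> * (Re q + 1) powr - e" if "Re q > -1" for q
      using decay_gauss_pair_bound_scaled[OF g decay \<rho> that] by (simp add: e_def)
    show "?V (of_real x) = transplant b ?W (of_real x)" if "0 < x" "x < 1" for x
      unfolding b_def \<rho>_def using T shift that by (rule gauss_pair_eq_transplant)
  qed (use e \<rho> p beta_plus_1_pos[of j] in \<open>auto simp: b_def\<close>)
  then show ?thesis using \<rho> by simp
qed

lemma heat_flow_zero_if_gaussian_decay:
  assumes C1: "C1_W2 k n T u u'"
    and heat: "\<forall>t\<in>{0..T}. AE x in \<mu>. of_real (real n) * wlap k n (u t) x - u' t x = 0"
    and T: "T > 0" and decay: "\<And>x. norm (u T x) \<le> C * exp (- (real n / (4 * T)) * rad x)"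
    and t: "t \<in> {0..T}"
  shows "AE x in \<mu>. u t x = 0"
proof -
  have u: "memL k n 2 (u t)" if "t \<in> {0..T}" for t
    by (rule in_W2_L2[OF solution_in_W2[OF C1 heat that]])
  have initial: "gauss_pair j (u 0) (of_real p) = 0" if "j < 2" "p > 0" for j p
  proof (rule gauss_pair_zero_if_decaying_shift[OF _ _ T \<open>p > 0\<close> _ decay])
    show "spectral_pair j (u T) s = spectral_pair j (u 0) (s + real n * T)" if "s > 0" for s
      using spectral_pair_transport[OF C1 heat _ \<open>j < 2\<close> that] T by simp
  qed (use u[of 0] u[of T] T in \<open>auto simp: memL_2_iff\<close>)
  show ?thesis
  proof (rule AE_zero_if_gauss_pairs_zero[OF u[OF t]])
    fix j :: nat and p :: real
    assume j: "j < 2" and p: "p > 0"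
    have "dual p + real n * t > 0" using dual_pos[OF p] t by (simp add: add_pos_nonneg)
    then have "spectral_pair j (u 0) (dual p + real n * t) = 0"
      using initial[OF j dual_pos] by (simp add: spectral_pair_def)
    then have "spectral_pair j (u t) (dual p) = 0"
      using spectral_pair_transport[OF C1 heat t j dual_pos[OF p]] by simp
    then show "gauss_pair j (u t) (of_real p) = 0"
      using moment_pos[OF beta_plus_1_pos dual_pos[OF p], of j]
        by (simp add: spectral_pair_def dual_dual[OF p])
  qed
qed

end

theorem theorem4p1:
  fixes n :: nat and k T C \<delta> :: real
    and u u' :: "real \<Rightarrow> real \<Rightarrow> complex"
  assumes "n \<ge> 1"
    and "k \<ge> (real n - 1) / (2 * real n)"
    and "2 * k + 2 / real n - 2 > 0"
    and "T > 0"
    and "C1_W2 k n T u u'"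
    and "\<forall>t\<in>{0..T}. AE x in mu_kn k n.
           complex_of_real (real n) * wlap k n (u t) x - u' t x = 0"
    and "memL k n 1 (u 0)"
    and "C > 0" and "\<delta> > 0"
    and "\<forall>x. norm (u T x) \<le> C * exp (- real n * \<delta> * \<bar>x\<bar> powr (2 / real n))"
    and "\<delta> \<ge> 1 / (4 * T)"
  shows "\<forall>t\<in>{0..T}. AE x in mu_kn k n. u t x = 0"
proof
  interpret generalized_fourier k n by unfold_locales fact+
  have rate: "real n / (4 * T) \<le> real n * \<delta>"
    using mult_left_mono[OF \<open>\<delta> \<ge> 1 / (4 * T)\<close>, of "real n"] by simp
  have decay: "norm (u T x) \<le> C * exp (- (real n / (4 * T)) * rad x)" for x
  proof -
    have "norm (u T x) \<le> C * exp (- (real n * \<delta>) * rad x)"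
      using assms(10) by (simp add: rad_def)
    also have "\<dots> \<le> C * exp (- (real n / (4 * T)) * rad x)"
      using mult_right_mono[OF rate, of "rad x"] \<open>C > 0\<close> by simp
    finally show ?thesis .
  qed
  fix t assume "t \<in> {0..T}"
  with assms(5,6) \<open>T > 0\<close> decay show "AE x in mu_kn k n. u t x = 0"
    by (intro heat_flow_zero_if_gaussian_decay)
qed

end
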